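(* Let $V\in\mathcal{C}^\alpha(\bar{D})$ for some $\alpha>0$ and suppose that $\lambda^*(-L+V)>0$. Let $u\in\mathcal{C}_b(\mathbb{R}^d)$ be a viscosity subsolution of $-Lu+Vu\le 0$ in $D$ and let $v\in\mathcal{C}_b(\mathbb{R}^d)$ be a viscosity supersolution of $-Lv+Vv\ge 0$ in $D$. Assume furthermore that $u\le v$ in $D^c$. Then $u\le v$ in $\mathbb{R}^d$.
   Context: $D\subset\mathbb{R}^d$ is a bounded domain with $\mathcal{C}^2$ boundary, $D^c=\mathbb{R}^d\setminus D$, $s\in(0,1)$, and $L$ is the operator $$Lu(x)=\int_{\mathbb{R}^d}\big(u(x+y)-u(x)-\nabla u(x)\cdot y\,\mathbf{1}_{\{|y|\le 1\}}\big)\frac{k(y/|y|)}{|y|^{d+2s}}\,dy,$$ where $k:\mathbb{S}^{d-1}\to(0,\infty)$ is a Borel-measurable symmetric function ($k(z)=k(-z)$) with $0<\Lambda_1\le k(z)\le\Lambda_2$ for all $z\in\mathbb{S}^{d-1}$, $\Lambda_1,\Lambda_2$ constants. (By the symmetry of $k$, $Lu(x)=\frac12\int_{\mathbb{R}^d}(u(x+y)+u(x-y)-2u(x))\frac{k(y/|y|)}{|y|^{d+2s}}\,dy$; this form is used for functions of class $\mathcal{C}^{2s+}$ that need not be differentiable.) $\mathcal{C}_b(\mathbb{R}^d)$ (resp. $\mathcal{C}_{b,+}(\mathbb{R}^d)$) is the set of bounded continuous (resp. non-negative bounded continuous) functions on $\mathbb{R}^d$. $\mathcal{C}^{2s+}(D)$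 is the set of continuous functions $\psi$ on $D$ such that for every compact $K\subset D$ there is $\gamma>0$ with $\psi\in\mathcal{C}^{2s+\gamma}(K)$. For $V\in\mathcal{C}(\bar D)$ the principal eigenvalue of $-L+V$ in $D$ is $$\lambda^*(-L+V)=\sup\{\lambda\in\mathbb{R}: \mathfrak{F}(\lambda,D)\ne\emptyset\},$$ $$\mathfrak{F}(\lambda,D)=\{\psi\in\mathcal{C}_{b,+}(\mathbb{R}^d)\cap\mathcal{C}^{2s+}(D): \psi>0 \text{ in } D,\ L\psi-V\psi+\lambda\psi\le 0 \text{ in } D\}.$$ Viscosity solutions: $u\in\mathcal{C}_b(\mathbb{R}^d)$ is a viscosity subsolution of $-Lu+Vu\le g$ in $D$ if, whenever $x\in D$, $B_r(x)$ is a ball contained in $D$, and $\varphi\in\mathcal{C}^2(D)$ satisfies $\varphi(x)=u(x)$ and $\varphi>u$ in $B_r(x)\setminus\{x\}$, the function $\varphi_r$ equal to $\varphi$ in $B_r(x)$ and to $u$ in $B_r(x)^c$ satisfies $-L\varphi_r(x)+V(x)u(x)\le g(x)$. Viscosity supersolutions of $-Lu+Vu\ge g$ are defined in the same way with test functions touching from below ($\varphi<u$ in $B_r(x)\setminus\{x\}$) and the final inequality reversed. *)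

theory Defs
  imports "HOL-Analysis.Analysis"
begin

section \<open>Regularity of functions and domains\<close>

definition C2_on :: "'a::euclidean_space set \<Rightarrow> ('a \<Rightarrow> real) \<Rightarrow> bool" where
  "C2_on S f \<longleftrightarrow> (\<exists>(g :: 'a \<Rightarrow> 'a) (H :: 'a \<Rightarrow> ('a \<Rightarrow>\<^sub>L 'a)).
     (\<forall>x\<in>S. (f has_derivative (\<lambda>h. g x \<bullet> h)) (at x)) \<and>
     (\<forall>x\<in>S. (g has_derivative blinfun_apply (H x)) (at x)) \<and>
     continuous_on S H)"

text \<open>Near each boundary point the set is the strict epigraph of a \<open>C\<^sup>2\<close> function over
  the hyperplane orthogonal to some unit vector \<open>e\<close>.  The function \<open>g\<close> lives on the whole
  space but is only evaluated at the orthogonal projection of \<open>x\<close> onto that hyperplane.\<close>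

definition C2_boundary :: "'a::euclidean_space set \<Rightarrow> bool" where
  "C2_boundary D \<longleftrightarrow> (\<forall>z\<in>frontier D. \<exists>r>0. \<exists>e g. norm e = 1 \<and> C2_on UNIV g \<and>
     D \<inter> ball z r = {x \<in> ball z r. g (x - (x \<bullet> e) *\<^sub>R e) < x \<bullet> e})"

definition bounded_C2_domain :: "'a::euclidean_space set \<Rightarrow> bool" where
  "bounded_C2_domain D \<longleftrightarrow>
     D \<noteq> {} \<and> open D \<and> connected D \<and> bounded D \<and> C2_boundary D"

text \<open>\<open>C_hoelder m \<theta> S\<close> is \<open>C\<^sup>m\<^sup>,\<^sup>\<theta>(S)\<close>, the derivatives being taken within \<open>S\<close> (one-sided at
  boundary points).  For \<open>\<theta> = 0\<close> the last conjunct of the base case only repeats boundedness,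
  so that \<open>C_hoelder m 0 S\<close> is the class of \<open>C\<^sup>m\<close> functions with bounded derivatives.\<close>

primrec C_hoelder :: "nat \<Rightarrow> real \<Rightarrow> 'a::euclidean_space set \<Rightarrow> ('a \<Rightarrow> real) \<Rightarrow> bool" where
  "C_hoelder 0 \<theta> S f \<longleftrightarrow> continuous_on S f \<and> bounded (f ` S) \<and>
     (\<exists>C. \<forall>x\<in>S. \<forall>y\<in>S. \<bar>f x - f y\<bar> \<le> C * norm (x - y) powr \<theta>)"
| "C_hoelder (Suc m) \<theta> S f \<longleftrightarrow> bounded (f ` S) \<and>
     (\<exists>g :: 'a \<Rightarrow> 'a. (\<forall>x\<in>S. (f has_derivative (\<lambda>h. g x \<bullet> h)) (at x within S)) \<and>
        (\<forall>b\<in>Basis. C_hoelder m \<theta> S (\<lambda>x. g x \<bullet> b)))"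

definition C_real :: "real \<Rightarrow> 'a::euclidean_space set \<Rightarrow> ('a \<Rightarrow> real) \<Rightarrow> bool" where
  "C_real \<beta> S f \<longleftrightarrow> C_hoelder (nat \<lfloor>\<beta>\<rfloor>) (frac \<beta>) S f"

definition C_2s_plus :: "real \<Rightarrow> 'a::euclidean_space set \<Rightarrow> ('a \<Rightarrow> real) \<Rightarrow> bool" where
  "C_2s_plus s D \<psi> \<longleftrightarrow> continuous_on D \<psi> \<and>
     (\<forall>K. compact K \<and> K \<subseteq> D \<longrightarrow> (\<exists>\<gamma>>0. C_real (2 * s + \<gamma>) K \<psi>))"

section \<open>The nonlocal operator\<close>

text \<open>Only the values of \<open>k\<close> on the unit sphere matter.\<close>

definition admissible_kernel :: "('a::euclidean_space \<Rightarrow> real) \<Rightarrow> bool" where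
  "admissible_kernel k \<longleftrightarrow>
     k \<in> borel_measurable (restrict_space borel (sphere 0 1)) \<and>
     (\<forall>z\<in>sphere 0 1. k z = k (- z)) \<and>
     (\<exists>\<Lambda>1 \<Lambda>2. 0 < \<Lambda>1 \<and> (\<forall>z\<in>sphere 0 1. \<Lambda>1 \<le> k z \<and> k z \<le> \<Lambda>2))"

definition jump_density :: "('a::euclidean_space \<Rightarrow> real) \<Rightarrow> real \<Rightarrow> 'a \<Rightarrow> real" where
  "jump_density k s y = k (y /\<^sub>R norm y) / norm y powr (real DIM('a) + 2 * s)"

definition L_integrand ::
    "('a::euclidean_space \<Rightarrow> real) \<Rightarrow> real \<Rightarrow> ('a \<Rightarrow> real) \<Rightarrow> 'a \<Rightarrow> 'a \<Rightarrow> real" where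
  "L_integrand k s u x y = (u (x + y) + u (x - y) - 2 * u x) * jump_density k s y"

definition L_op :: "('a::euclidean_space \<Rightarrow> real) \<Rightarrow> real \<Rightarrow> ('a \<Rightarrow> real) \<Rightarrow> 'a \<Rightarrow> real" where
  "L_op k s u x = (1 / 2) * (\<integral>y. L_integrand k s u x y \<partial>lborel)"

text \<open>For even \<open>k\<close> this agrees with the form of the operator that carries a first-order
  correction (with \<open>p\<close> the gradient of \<open>u\<close> at \<open>x\<close>), whenever the latter integral converges.\<close>

lemma
  fixes k u :: "'a::euclidean_space \<Rightarrow> real"
  assumes k: "admissible_kernel k"
    and int: "integrable lborel
      (\<lambda>y. (u (x + y) - u x - (p \<bullet> y) * indicator (cball 0 1) y) * jump_density k s y)"
  shows L_integrand_integrable: "integrable lborel (L_integrand k s u x)"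
    and L_op_eq_gradient_form: "L_op k s u x =
      (\<integral>y. (u (x + y) - u x - (p \<bullet> y) * indicator (cball 0 1) y) * jump_density k s y \<partial>lborel)"
proof -
  define f where
    "f y = (u (x + y) - u x - (p \<bullet> y) * indicator (cball 0 1) y) * jump_density k s y" for y
  have lb: "distr lborel borel uminus = (lborel :: 'a measure)"
    using lborel_affine[of "-1" "0 :: 'a"] by (simp add: density_1)
  have int_f: "integrable lborel f"
    using int unfolding f_def .
  then have [measurable]: "f \<in> borel_measurable borel"
    by simp
  have "integrable (distr lborel borel uminus) f"
    using int_f by (simp add: lb)
  then have int_m: "integrable lborel (\<lambda>y. f (- y))"
    by (subst (asm) integrable_distr_eq) auto
  have "(\<integral>y. f y \<partial>distr lborel borel uminus) = (\<integral>y. f (- y) \<partial>lborel)"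
    by (rule integral_distr) auto
  then have eq_m: "(\<integral>y. f (- y) \<partial>lborel) = (\<integral>y. f y \<partial>lborel)"
    by (simp add: lb)
  have even: "jump_density k s (- y) = jump_density k s y" for y
  proof (cases "y = 0")
    case False
    then have "y /\<^sub>R norm y \<in> sphere 0 1" by simp
    then have "k (y /\<^sub>R norm y) = k (- (y /\<^sub>R norm y))"
      using k unfolding admissible_kernel_def by blast
    then show ?thesis
      by (simp add: jump_density_def)
  qed simp
  have split: "L_integrand k s u x = (\<lambda>y. f y + f (- y))"
    by (rule ext) (simp add: L_integrand_def f_def even indicator_def algebra_simps)
  show "integrable lborel (L_integrand k s u x)"
    unfolding split using int_f int_m by simp
  have "L_op k s u x = (1 / 2) * ((\<integral>y. f y \<partial>lborel) + (\<integral>y. f (- y) \<partial>lborel))"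
    unfolding L_op_def split using int_f int_m by simp
  also have "\<dots> = (\<integral>y. f y \<partial>lborel)"
    unfolding eq_m by simp
  finally show "L_op k s u x = (\<integral>y. (u (x + y) - u x - (p \<bullet> y) * indicator (cball 0 1) y)
      * jump_density k s y \<partial>lborel)"
    unfolding f_def .
qed

section \<open>The principal eigenvalue\<close>

definition eigen_supersolutions ::
    "('a::euclidean_space \<Rightarrow> real) \<Rightarrow> real \<Rightarrow> ('a \<Rightarrow> real) \<Rightarrow> 'a set \<Rightarrow> real \<Rightarrow> ('a \<Rightarrow> real) set" where
  "eigen_supersolutions k s V D lam =
     {\<psi> \<in> bcontfun. (\<forall>x. 0 \<le> \<psi> x) \<and> C_2s_plus s D \<psi> \<and> (\<forall>x\<in>D. 0 < \<psi> x) \<and>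
        (\<forall>x\<in>D. L_op k s \<psi> x - V x * \<psi> x + lam * \<psi> x \<le> 0)}"

definition principal_eigenvalue ::
    "('a::euclidean_space \<Rightarrow> real) \<Rightarrow> real \<Rightarrow> ('a \<Rightarrow> real) \<Rightarrow> 'a set \<Rightarrow> ereal" where
  "principal_eigenvalue k s V D = Sup (ereal ` {lam. eigen_supersolutions k s V D lam \<noteq> {}})"

section \<open>Viscosity solutions\<close>

definition glue :: "('a::metric_space \<Rightarrow> real) \<Rightarrow> ('a \<Rightarrow> real) \<Rightarrow> 'a \<Rightarrow> real \<Rightarrow> 'a \<Rightarrow> real" where
  "glue \<phi> u x r y = (if y \<in> ball x r then \<phi> y else u y)"

text \<open>A test function may be unbounded in \<open>ball x r\<close> if this ball touches the boundary of \<open>D\<close>.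
  Since \<open>\<phi> > u\<close> there and \<open>u\<close> is bounded, the integral defining \<open>L\<close> then either converges or
  diverges to \<open>+\<infinity>\<close>; in the second case the inequality \<open>- L \<phi>\<^sub>r x + V x u x \<le> g x\<close> is
  trivially true, which the integrability premise expresses (a divergent Bochner integral
  would otherwise count as \<open>0\<close>).  Symmetrically for supersolutions.\<close>

definition viscosity_subsolution ::
    "('a::euclidean_space \<Rightarrow> real) \<Rightarrow> real \<Rightarrow> 'a set \<Rightarrow> ('a \<Rightarrow> real) \<Rightarrow> ('a \<Rightarrow> real) \<Rightarrow>
     ('a \<Rightarrow> real) \<Rightarrow> bool" where
  "viscosity_subsolution k s D V g u \<longleftrightarrow> u \<in> bcontfun \<and>
     (\<forall>x\<in>D. \<forall>r>0. \<forall>\<phi>. ball x r \<subseteq> D \<and> C2_on D \<phi> \<and> \<phi> x = u x \<and>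
        (\<forall>y \<in> ball x r - {x}. u y < \<phi> y) \<and>
        integrable lborel (L_integrand k s (glue \<phi> u x r) x) \<longrightarrow>
        - L_op k s (glue \<phi> u x r) x + V x * u x \<le> g x)"

definition viscosity_supersolution ::
    "('a::euclidean_space \<Rightarrow> real) \<Rightarrow> real \<Rightarrow> 'a set \<Rightarrow> ('a \<Rightarrow> real) \<Rightarrow> ('a \<Rightarrow> real) \<Rightarrow>
     ('a \<Rightarrow> real) \<Rightarrow> bool" where
  "viscosity_supersolution k s D V g u \<longleftrightarrow> u \<in> bcontfun \<and>
     (\<forall>x\<in>D. \<forall>r>0. \<forall>\<phi>. ball x r \<subseteq> D \<and> C2_on D \<phi> \<and> \<phi> x = u x \<and>
        (\<forall>y \<in> ball x r - {x}. \<phi> y < u y) \<and>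
        integrable lborel (L_integrand k s (glue \<phi> u x r) x) \<longrightarrow>
        - L_op k s (glue \<phi> u x r) x + V x * u x \<ge> g x)"

end

theory Submission
  imports Defs
begin

text \<open>
  The number \<open>\<lambda>\<^sup>* > 0\<close> provides a function \<open>\<psi> \<ge> 0\<close>, positive in \<open>D\<close>, with
  \<open>L \<psi> - V \<psi> + \<lambda> \<psi> \<le> 0\<close> in \<open>D\<close> for some \<open>\<lambda> > 0\<close>.  Such a strict supersolution is a yardstick
  for \<open>u - v\<close>: if \<open>t \<psi>\<close> with \<open>t > 0\<close> touches \<open>u - v\<close> from above at a point \<open>x\<close> of \<open>D\<close>, then
  \<open>W = u - v - t \<psi>\<close> has a global maximum at \<open>x\<close>, so \<open>L W x \<le> 0\<close>, whereas the three inequalities add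
  up to \<open>L W x \<ge> V x * W x + \<lambda> t \<psi> x = \<lambda> t \<psi> x > 0\<close>.

  The function \<open>\<psi>\<close> may vanish on the boundary of \<open>D\<close>, so a smallest such \<open>t\<close> need not exist a priori.
  The remedy is a maximum principle for sets of small measure.  Choose a compact \<open>K \<subseteq> D\<close> with
  \<open>D - K\<close> of small measure and let \<open>t \<ge> 0\<close> be least with \<open>u - v \<le> t \<psi>\<close> on \<open>K\<close>.  If \<open>W\<close> had a
  positive maximum \<open>M\<close>, it would be attained in \<open>D - K\<close>, and \<open>W \<le> 0\<close> off \<open>D - K\<close>; jumps from the
  maximum point out of \<open>D - K\<close> then contribute to \<open>L W\<close> at most \<open>- M\<close> times the mass that the jump
  kernel gives to them.  As the kernel is not integrable at the origin, that mass exceeds any bound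
  when \<open>D - K\<close> is small enough (\<open>kernel_mass_off_small_set\<close>), and it beats \<open>V x * W x\<close>.  So \<open>W \<le> 0\<close>
  everywhere, and the first paragraph excludes \<open>t > 0\<close>; hence \<open>u \<le> v\<close>.

  Both steps apply \<open>L\<close> to \<open>u - v - t \<psi>\<close>, although \<open>u\<close> and \<open>v\<close> satisfy their inequalities only in the
  viscosity sense.  The point is thus that a sum of viscosity subsolutions is a subsolution
  (\<open>punctual_subsolution_add\<close>), which is proved by doubling the variables.  The penalty
  \<open>n |x - y|\<^sup>2\<close> is invariant under common shifts of \<open>x\<close> and \<open>y\<close>, so at a maximum of the doubled
  function the two second differences have a sum that the penalty does not see; and because the order
  \<open>2 s\<close> of the operator is less than \<open>2\<close>, a quadratic test function contributes nothing to \<open>L\<close> in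
  the limit where its ball shrinks.  It is therefore convenient to express all inequalities by
  the operator \<open>L_trunc\<close> that omits jumps shorter than \<open>\<rho>\<close>, and to let \<open>\<rho>\<close> tend to \<open>0\<close>
  (\<open>punctual_subsolution\<close>).
\<close>

section \<open>Integrability of powers of the norm\<close>

text \<open>The shells \<open>{h. r * b ^ n \<le> norm h \<le> 2 * (r * b ^ n)}\<close> exhaust the exterior of a ball
  for \<open>b = 2\<close> and the punctured ball for \<open>b = 1/2\<close>.\<close>

lemma dyadic_shell_exists:
  fixes t r :: real
  assumes "0 < r"
  shows "r \<le> t \<Longrightarrow> \<exists>n. r * 2 ^ n \<le> t \<and> t \<le> 2 * (r * 2 ^ n)"
    and "0 < t \<Longrightarrow> t \<le> r \<Longrightarrow> \<exists>n. r * (1/2) ^ n \<le> t \<and> t \<le> 2 * (r * (1/2) ^ n)"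
proof -
  have up: "\<exists>n. a * 2 ^ n \<le> b \<and> b \<le> 2 * (a * 2 ^ n)" if "0 < a" "a \<le> b" for a b :: real
  proof -
    obtain m where "b / a < 2 ^ m"
      using real_arch_pow[of 2 "b / a"] by auto
    then have ex: "\<exists>n. b < a * 2 ^ Suc n"
      using that by (intro exI[of _ m]) (simp add: field_simps)
    define n where "n = (LEAST n. b < a * 2 ^ Suc n)"
    have 1: "b < a * 2 ^ Suc n"
      unfolding n_def by (rule LeastI_ex) (rule ex)
    have 2: "a * 2 ^ n \<le> b"
    proof (cases n)
      case (Suc k)
      then have "\<not> b < a * 2 ^ Suc k"
        unfolding n_def by (intro not_less_Least) simp
      then show ?thesis using Suc by simp
    qed (use that in simp)
    from 1 2 show ?thesis by (intro exI[of _ n]) simp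
  qed
  show "\<exists>n. r * 2 ^ n \<le> t \<and> t \<le> 2 * (r * 2 ^ n)" if "r \<le> t"
    using up[OF assms that] .
  show "\<exists>n. r * (1/2) ^ n \<le> t \<and> t \<le> 2 * (r * (1/2) ^ n)" if t: "0 < t" "t \<le> r"
  proof -
    obtain n where "t * 2 ^ n \<le> r" "r \<le> 2 * (t * 2 ^ n)"
      using up[OF t] by blast
    then have "r * (1/2) ^ Suc n \<le> t" "t \<le> r * (1/2) ^ n"
      by (simp_all add: field_simps power_divide)
    then show ?thesis by (intro exI[of _ "Suc n"]) simp
  qed
qed

text \<open>On the \<open>n\<close>-th dyadic shell the integrand is comparable to \<open>(r * b ^ n) powr q\<close>, and the volume of
  the shell is at most a multiple of \<open>(r * b ^ n) ^ DIM('a)\<close>.  The integral is therefore dominated by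
  a geometric series with ratio \<open>b powr (DIM('a) + q)\<close>.\<close>

lemma set_integrable_norm_powr:
  fixes A :: "'a::euclidean_space set" and q b r :: real
  assumes A: "A \<in> sets borel" and "0 < r" "0 < b"
    and conv: "b powr (real DIM('a) + q) < 1"
    and shells: "\<And>h. h \<in> A \<Longrightarrow> h \<noteq> 0 \<Longrightarrow> \<exists>n. r * b ^ n \<le> norm h \<and> norm h \<le> 2 * (r * b ^ n)"
  shows "set_integrable lborel A (\<lambda>h. norm h powr q)"
proof -
  define d where "d = DIM('a)"
  define \<omega> where "\<omega> = measure lborel (cball (0::'a) 1)"
  define c where "c n = 2 powr \<bar>q\<bar> * (r * b ^ n) powr q" for n
  have c0: "0 \<le> c n" for n by (simp add: c_def)
  have vol: "emeasure lborel (cball (0::'a) (2 * (r * b ^ n))) = ennreal ((2 * (r * b ^ n)) ^ d * \<omega>)" for n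
  proof -
    have "measure lborel (cball (0::'a) (2 * (r * b ^ n))) = (2 * (r * b ^ n)) ^ d * \<omega>"
      unfolding d_def \<omega>_def using assms by (simp add: content_cball_conv_ball content_ball_conv_unit_ball[of "2 * (r * b ^ n)"])
    then show ?thesis
      by (metis emeasure_eq_ennreal_measure emeasure_lborel_cball_finite infinity_ennreal_def order_less_irrefl)
  qed
  have bound: "norm h powr q \<le> c n" if "r * b ^ n \<le> norm h" "norm h \<le> 2 * (r * b ^ n)" for h :: 'a and n
  proof -
    have p: "0 < r * b ^ n" using assms by simp
    define t where "t = norm h / (r * b ^ n)"
    have t: "1 \<le> t" "t \<le> 2" using that p by (auto simp: t_def field_simps)
    have "t powr q \<le> t powr \<bar>q\<bar>" using t by (intro powr_mono) auto
    also have "\<dots> \<le> 2 powr \<bar>q\<bar>" using t by (intro powr_mono2) auto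
    finally have "t powr q * (r * b ^ n) powr q \<le> c n"
      unfolding c_def by (intro mult_right_mono) auto
    moreover have "norm h powr q = t powr q * (r * b ^ n) powr q"
      using p t assms by (simp add: powr_mult[symmetric] t_def)
    ultimately show ?thesis by simp
  qed
  have "(\<integral>\<^sup>+h. ennreal (norm (indicator A h *\<^sub>R norm h powr q)) \<partial>lborel) \<le>
      (\<integral>\<^sup>+h. (\<Sum>n. ennreal (c n) * indicator (cball (0::'a) (2 * (r * b ^ n))) h) \<partial>lborel)"
  proof (rule nn_integral_mono)
    fix h :: 'a
    show "ennreal (norm (indicator A h *\<^sub>R norm h powr q)) \<le> (\<Sum>n. ennreal (c n) * indicator (cball 0 (2 * (r * b ^ n))) h)"
    proof (cases "h \<in> A \<and> h \<noteq> 0")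
      case True
      then obtain n where n: "r * b ^ n \<le> norm h" "norm h \<le> 2 * (r * b ^ n)"
        using shells by blast
      have "ennreal (norm (indicator A h *\<^sub>R norm h powr q)) \<le> ennreal (c n)"
        using bound[OF n] True by (intro ennreal_leI) simp
      also have "\<dots> = (\<Sum>i\<in>{n}. ennreal (c i) * indicator (cball 0 (2 * (r * b ^ i))) h)"
        using n by simp
      also have "\<dots> \<le> (\<Sum>i. ennreal (c i) * indicator (cball 0 (2 * (r * b ^ i))) h)"
        by (intro sum_le_suminf) auto
      finally show ?thesis .
    qed auto
  qed
  also have "\<dots> = (\<Sum>n. ennreal (c n) * ennreal ((2 * (r * b ^ n)) ^ d * \<omega>))"
  proof -
    have [measurable]: "cball (0::'a) t \<in> sets borel" for t by simp
    show ?thesis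
      by (subst nn_integral_suminf) (measurable, simp only: nn_integral_cmult_indicator sets_lborel borel_closed closed_cball vol)
  qed
  also have "\<dots> = (\<Sum>n. ennreal (2 powr \<bar>q\<bar> * 2 ^ d * \<omega> * r powr (real d + q) * (b powr (real d + q)) ^ n))"
  proof (intro suminf_cong)
    fix n
    have p: "0 < r * b ^ n" using assms by simp
    have "(r * b ^ n) ^ d * (r * b ^ n) powr q = (r * b ^ n) powr (real d + q)"
      using p by (simp add: powr_add powr_realpow)
    also have "\<dots> = r powr (real d + q) * (b powr (real d + q)) ^ n"
      using assms by (simp add: powr_mult powr_powr powr_realpow[symmetric] mult.commute)
    finally have "c n * ((2 * (r * b ^ n)) ^ d * \<omega>) = 2 powr \<bar>q\<bar> * 2 ^ d * \<omega> * r powr (real d + q) * (b powr (real d + q)) ^ n"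
      by (simp add: c_def power_mult_distrib mult_ac)
    then show "ennreal (c n) * ennreal ((2 * (r * b ^ n)) ^ d * \<omega>) =
      ennreal (2 powr \<bar>q\<bar> * 2 ^ d * \<omega> * r powr (real d + q) * (b powr (real d + q)) ^ n)"
      using c0 by (metis ennreal_mult')
  qed
  also have "\<dots> < \<infinity>"
  proof -
    have "summable (\<lambda>n. 2 powr \<bar>q\<bar> * 2 ^ d * \<omega> * r powr (real d + q) * (b powr (real d + q)) ^ n)"
      using conv by (intro summable_mult summable_geometric) (simp add: d_def)
    then show ?thesis
      by (subst suminf_ennreal2) (auto simp: \<omega>_def)
  qed
  finally show ?thesis
    unfolding set_integrable_def using A by (intro integrableI_bounded) auto
qed

lemma set_integrable_norm_powr_ball:
  assumes "0 < real DIM('a) + q" "0 < r"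
  shows "set_integrable lborel (ball 0 r) (\<lambda>h :: 'a::euclidean_space. norm h powr q)"
proof -
  have "(1/2) powr (real DIM('a) + q) < 1 powr (real DIM('a) + q)"
    using assms by (intro powr_less_mono2) auto
  then show ?thesis
    using assms dyadic_shell_exists(2)[of r]
    by (intro set_integrable_norm_powr[of _ r "1/2"]) auto
qed

lemma set_integrable_norm_powr_compl_ball:
  assumes "real DIM('a) + q < 0" "0 < r"
  shows "set_integrable lborel (- ball 0 r) (\<lambda>h :: 'a::euclidean_space. norm h powr q)"
proof -
  have "(2::real) powr (real DIM('a) + q) < 1"
    using assms by (simp add: powr_less_one)
  then show ?thesis
    using assms dyadic_shell_exists(1)[of r]
    by (intro set_integrable_norm_powr[of _ r 2]) auto
qed

section \<open>The jump kernel and the truncated operator\<close>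

lemma bcontfun_continuous: "f \<in> bcontfun \<Longrightarrow> continuous_on S f" for f :: "'a::metric_space \<Rightarrow> 'b::metric_space"
  by (auto simp: bcontfun_def intro: continuous_on_subset)

lemma bcontfun_abs_bound:
  fixes f :: "'a::metric_space \<Rightarrow> real"
  assumes "f \<in> bcontfun"
  obtains B where "\<And>y. \<bar>f y\<bar> \<le> B"
  using assms by (auto simp: bcontfun_def bounded_iff)

lemma set_integral_ball_tendsto_0:
  fixes f :: "'a::euclidean_space \<Rightarrow> real"
  assumes "set_integrable lborel (ball 0 R) f" "0 < R"
  shows "((\<lambda>\<rho>. LINT h:ball 0 \<rho>|lborel. f h) \<longlongrightarrow> 0) (at_right 0)"
  unfolding tendsto_at_iff_sequentially
proof (intro allI impI)
  fix X :: "nat \<Rightarrow> real"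
  assume pos: "\<forall>i. X i \<in> {0<..} - {0}" and X: "X \<longlonglongrightarrow> 0"
  define F where "F h = indicator (ball 0 R) h * f h" for h
  have int: "integrable lborel F"
    using assms(1) unfolding set_integrable_def F_def by simp
  have 1: "(\<lambda>i. LINT h|lborel. indicator (ball 0 (X i)) h * F h) \<longlonglongrightarrow> (LINT h::'a|lborel. (0::real))"
  proof (rule integral_dominated_convergence[where w = "\<lambda>h. norm (F h)"])
    show "AE h in lborel. (\<lambda>i. indicator (ball 0 (X i)) h * F h) \<longlonglongrightarrow> 0"
      using AE_lborel_singleton[of 0]
    proof eventually_elim
      case (elim h)
      then have "\<forall>\<^sub>F i in sequentially. X i < norm h"
        using X by (intro order_tendstoD) auto
      then have "\<forall>\<^sub>F i in sequentially. indicator (ball 0 (X i)) h * F h = 0"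
        by eventually_elim (simp add: indicator_def)
      then show ?case by (rule tendsto_eventually)
    qed
  qed (use int in \<open>auto simp: indicator_def intro: borel_measurable_integrable\<close>)
  have "\<forall>\<^sub>F i in sequentially. X i < R"
    using X assms by (intro order_tendstoD) auto
  then have "\<forall>\<^sub>F i in sequentially. (LINT h|lborel. indicator (ball 0 (X i)) h * F h) = (LINT h:ball 0 (X i)|lborel. f h)"
  proof eventually_elim
    case (elim i)
    then show ?case
      unfolding set_lebesgue_integral_def F_def
      by (intro Bochner_Integration.integral_cong) (auto simp: indicator_def)
  qed
  then show "((\<lambda>\<rho>. LINT h:ball 0 \<rho>|lborel. f h) \<circ> X) \<longlonglongrightarrow> 0"
    using 1 by (simp add: comp_def tendsto_cong)
qed

lemma ball_measurable [measurable]: "ball x r \<in> sets borel" for x :: "'a::metric_space"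
  by simp

text \<open>For bounded continuous \<open>u\<close> the omission of jumps shorter than \<open>\<rho>\<close> makes the integral converge and
  depend continuously on \<open>x\<close>; both can fail for \<open>L_op\<close>.\<close>

definition L_trunc ::
    "('a::euclidean_space \<Rightarrow> real) \<Rightarrow> real \<Rightarrow> real \<Rightarrow> ('a \<Rightarrow> real) \<Rightarrow> 'a \<Rightarrow> real" where
  "L_trunc k s \<rho> u x = (1 / 2) * (LINT y:- ball 0 \<rho>|lborel. L_integrand k s u x y)"

locale stable_kernel =
  fixes k :: "'a::euclidean_space \<Rightarrow> real" and s :: real
  assumes s: "0 < s" "s < 1" and kernel: "admissible_kernel k"
begin

abbreviation j :: "'a \<Rightarrow> real" where "j \<equiv> jump_density k s"

lemma jump_density_measurable [measurable]: "j \<in> borel_measurable borel"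
proof -
  define g where "g y = (if y \<in> - {0} then k (y /\<^sub>R norm y) else 0)" for y
  have "(\<lambda>y. y /\<^sub>R norm y) \<in> measurable (restrict_space borel (- {0})) (restrict_space borel (sphere (0::'a) 1))"
    by (intro measurable_restrict_space3) auto
  moreover have "k \<in> borel_measurable (restrict_space borel (sphere 0 1))"
    using kernel by (simp add: admissible_kernel_def)
  ultimately have "(\<lambda>y. k (y /\<^sub>R norm y)) \<in> borel_measurable (restrict_space borel (- {0}))"
    by (rule measurable_compose)
  then have [measurable]: "g \<in> borel_measurable borel"
    unfolding g_def by (subst (asm) measurable_restrict_space_iff[where c = 0]) auto
  have "j = (\<lambda>y. g y / norm y powr (real DIM('a) + 2 * s))"
    by (auto simp: jump_density_def g_def fun_eq_iff)
  also have "\<dots> \<in> borel_measurable borel"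
    by measurable
  finally show ?thesis .
qed

lemma kernel_bounds:
  obtains \<Lambda>1 \<Lambda>2 where "0 < \<Lambda>1"
    "\<And>y. y \<noteq> 0 \<Longrightarrow> \<Lambda>1 * norm y powr - (real DIM('a) + 2 * s) \<le> j y"
    "\<And>y. j y \<le> \<Lambda>2 * norm y powr - (real DIM('a) + 2 * s)"
proof -
  obtain \<Lambda>1 \<Lambda>2 where L: "0 < \<Lambda>1" "\<And>z. z \<in> sphere 0 1 \<Longrightarrow> \<Lambda>1 \<le> k z \<and> k z \<le> \<Lambda>2"
    using kernel unfolding admissible_kernel_def by blast
  have j: "j y = k (y /\<^sub>R norm y) * norm y powr - (real DIM('a) + 2 * s)" for y
    unfolding jump_density_def powr_minus by (simp only: divide_inverse)
  have S: "y /\<^sub>R norm y \<in> sphere 0 1" if "y \<noteq> 0" for y :: 'a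
    using that by simp
  show ?thesis
  proof
    show "\<Lambda>1 * norm y powr - (real DIM('a) + 2 * s) \<le> j y" if "y \<noteq> 0" for y
      unfolding j using L(2)[OF S[OF that]] by (intro mult_right_mono) auto
    show "j y \<le> \<Lambda>2 * norm y powr - (real DIM('a) + 2 * s)" for y
      by (cases "y = 0") (use L(2)[OF S[of y]] in \<open>auto simp: j intro!: mult_right_mono\<close>)
  qed fact
qed

lemma jump_density_nonneg: "0 \<le> j y"
proof -
  obtain \<Lambda>1 \<Lambda>2 where "0 < \<Lambda>1" "\<And>y. y \<noteq> 0 \<Longrightarrow> \<Lambda>1 * norm y powr - (real DIM('a) + 2 * s) \<le> j y"
    using kernel_bounds by metis
  then show ?thesis
    by (cases "y = 0") (force simp: jump_density_def intro: order_trans[rotated])+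
qed

text \<open>This is the estimate that expresses that the operator has order \<open>2 s\<close>; since \<open>s < 1\<close> it
  covers \<open>p = 2\<close>, that is, quadratic test functions.\<close>

lemma jump_density_near_integrable:
  assumes "2 * s < p" "0 < r"
  shows "set_integrable lborel (ball 0 r) (\<lambda>y. norm y powr p * j y)"
proof -
  obtain \<Lambda>1 \<Lambda>2 where L: "\<And>y. j y \<le> \<Lambda>2 * norm y powr - (real DIM('a) + 2 * s)"
    using kernel_bounds by metis
  have int: "set_integrable lborel (ball 0 r) (\<lambda>y::'a. \<Lambda>2 * norm y powr (p - (real DIM('a) + 2 * s)))"
    using assms by (intro set_integrable_mult_right set_integrable_norm_powr_ball) auto
  show ?thesis
  proof (rule set_integrable_bound[OF int])
    show "AE y in lborel. y \<in> ball 0 r \<longrightarrow>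
        norm (norm y powr p * j y) \<le> norm (\<Lambda>2 * norm y powr (p - (real DIM('a) + 2 * s)))"
    proof (intro AE_I2 impI)
      fix y :: 'a
      have "norm y powr p * j y \<le> norm y powr p * (\<Lambda>2 * norm y powr - (real DIM('a) + 2 * s))"
        using L by (intro mult_left_mono) auto
      also have "\<dots> = \<Lambda>2 * norm y powr (p - (real DIM('a) + 2 * s))"
        by (simp add: powr_add[symmetric] algebra_simps)
      finally show "norm (norm y powr p * j y) \<le> norm (\<Lambda>2 * norm y powr (p - (real DIM('a) + 2 * s)))"
        using jump_density_nonneg[of y] by (simp add: abs_mult)
          (meson abs_ge_self mult_right_mono order_trans powr_ge_zero)
    qed
  qed (auto simp: set_borel_measurable_def)
qed

lemma jump_density_far_integrable:
  assumes "0 < r"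
  shows "set_integrable lborel (- ball 0 r) j"
proof -
  obtain \<Lambda>1 \<Lambda>2 where L: "\<And>y. j y \<le> \<Lambda>2 * norm y powr - (real DIM('a) + 2 * s)"
    using kernel_bounds by metis
  have int: "set_integrable lborel (- ball 0 r) (\<lambda>y::'a. \<Lambda>2 * norm y powr - (real DIM('a) + 2 * s))"
    using assms s by (intro set_integrable_mult_right set_integrable_norm_powr_compl_ball) auto
  show ?thesis
  proof (rule set_integrable_bound[OF int])
    show "AE y in lborel. y \<in> - ball 0 r \<longrightarrow>
        norm (j y) \<le> norm (\<Lambda>2 * norm y powr - (real DIM('a) + 2 * s))"
      using L jump_density_nonneg by (intro AE_I2 impI) (metis abs_le_iff abs_of_nonneg order_trans real_norm_def abs_ge_self)
  qed (auto simp: set_borel_measurable_def)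
qed

lemma L_integrand_measurable [measurable]:
  assumes [measurable]: "u \<in> borel_measurable borel"
  shows "L_integrand k s u x \<in> borel_measurable borel"
  unfolding L_integrand_def by measurable

lemma L_integrand_far_integrable:
  assumes u: "u \<in> borel_measurable borel" "\<And>y. \<bar>u y\<bar> \<le> B" and "0 < r"
  shows "set_integrable lborel (- ball 0 r) (L_integrand k s u x)"
proof -
  have int: "set_integrable lborel (- ball 0 r) (\<lambda>y. (4 * B) * j y)"
    using assms by (intro set_integrable_mult_right jump_density_far_integrable) auto
  show ?thesis
  proof (rule set_integrable_bound[OF int])
    show "AE y in lborel. y \<in> - ball 0 r \<longrightarrow>
        norm (L_integrand k s u x y) \<le> norm ((4 * B) * j y)"
    proof (intro AE_I2 impI)
      fix y
      have "\<bar>u (x + y) + u (x - y) - 2 * u x\<bar> \<le> 4 * B"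
        using u(2)[of "x + y"] u(2)[of "x - y"] u(2)[of x] by linarith
      then show "norm (L_integrand k s u x y) \<le> norm ((4 * B) * j y)"
        using jump_density_nonneg[of y]
        by (auto simp: L_integrand_def abs_mult intro!: mult_right_mono)
    qed
  qed (use u in \<open>auto simp: set_borel_measurable_def\<close>)
qed

lemma L_integrand_far_integrable_bcontfun:
  assumes u: "u \<in> bcontfun" and r: "0 < r"
  shows "set_integrable lborel (- ball 0 r) (L_integrand k s u x)"
proof -
  obtain B where "\<And>y. \<bar>u y\<bar> \<le> B" using bcontfun_abs_bound[OF u] by blast
  then show ?thesis
    using r bcontfun_continuous[OF u]
    by (intro L_integrand_far_integrable borel_measurable_continuous_onI)
qed

text \<open>Near the origin the second difference compensates for the singularity of the kernel; away from it
  the kernel itself is integrable and the function is bounded.\<close>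

lemma L_integrand_integrable_of_second_difference:
  assumes u: "u \<in> borel_measurable borel" "\<And>y. \<bar>u y\<bar> \<le> B" and "0 < r" "2 * s < p"
    and diff: "\<And>y. norm y < r \<Longrightarrow> \<bar>u (x + y) + u (x - y) - 2 * u x\<bar> \<le> C * norm y powr p"
  shows "integrable lborel (L_integrand k s u x)"
proof -
  have int: "set_integrable lborel (ball 0 r) (\<lambda>y. C * (norm y powr p * j y))"
    using assms by (intro set_integrable_mult_right jump_density_near_integrable) auto
  have [measurable]: "u \<in> borel_measurable borel" by fact
  have near: "set_integrable lborel (ball 0 r) (L_integrand k s u x)"
  proof (rule set_integrable_bound[OF int])
    show "AE y in lborel. y \<in> ball 0 r \<longrightarrow>
        norm (L_integrand k s u x y) \<le> norm (C * (norm y powr p * j y))"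
    proof (intro AE_I2 impI)
      fix y assume "y \<in> ball (0::'a) r"
      then have "\<bar>u (x + y) + u (x - y) - 2 * u x\<bar> * j y \<le> C * norm y powr p * j y"
        using jump_density_nonneg[of y] by (intro mult_right_mono diff) auto
      then show "norm (L_integrand k s u x y) \<le> norm (C * (norm y powr p * j y))"
        using jump_density_nonneg[of y] by (simp add: L_integrand_def abs_mult mult.assoc)
        (meson abs_ge_self mult_nonneg_nonneg mult_right_mono order_trans powr_ge_zero)
    qed
  qed (simp_all add: set_borel_measurable_def)
  have "set_integrable lborel (ball 0 r \<union> - ball 0 r) (L_integrand k s u x)"
    using near L_integrand_far_integrable[OF u] assms by (intro set_integrable_Un) auto
  then show ?thesis by (simp add: set_integrable_def)
qed

lemma L_op_split:
  assumes "integrable lborel (L_integrand k s u x)"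
  shows "L_op k s u x = (1/2) * (LINT y:ball 0 r|lborel. L_integrand k s u x y) + L_trunc k s r u x"
proof -
  have i: "set_integrable lborel A (L_integrand k s u x)" if "A \<in> sets borel" for A
    using assms that unfolding set_integrable_def by (intro integrable_mult_indicator) auto
  have "(LINT y:ball 0 r \<union> - ball 0 r|lborel. L_integrand k s u x y) =
     (LINT y:ball 0 r|lborel. L_integrand k s u x y) + (LINT y:- ball 0 r|lborel. L_integrand k s u x y)"
    by (intro set_integral_Un i) auto
  then show ?thesis
    by (simp add: L_op_def L_trunc_def set_lebesgue_integral_def algebra_simps)
qed

lemma L_trunc_tendsto_L_op:
  assumes "integrable lborel (L_integrand k s u x)"
  shows "((\<lambda>\<rho>. L_trunc k s \<rho> u x) \<longlongrightarrow> L_op k s u x) (at_right 0)"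
proof -
  have "set_integrable lborel (ball 0 1) (L_integrand k s u x)"
    using assms unfolding set_integrable_def by (intro integrable_mult_indicator) auto
  from set_integral_ball_tendsto_0[OF this]
  have "((\<lambda>\<rho>. L_op k s u x - (1/2) * (LINT y:ball 0 \<rho>|lborel. L_integrand k s u x y)) \<longlongrightarrow> L_op k s u x - (1/2) * 0) (at_right 0)"
    by (intro tendsto_intros) auto
  moreover have "L_op k s u x - (1/2) * (LINT y:ball 0 \<rho>|lborel. L_integrand k s u x y) = L_trunc k s \<rho> u x" for \<rho>
    using L_op_split[OF assms, of \<rho>] by simp
  ultimately show ?thesis by simp
qed

lemma L_trunc_tendsto:
  assumes u: "u \<in> bcontfun" and "0 < r" and X: "X \<longlonglongrightarrow> x"
  shows "(\<lambda>n. L_trunc k s r u (X n)) \<longlonglongrightarrow> L_trunc k s r u x"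
proof -
  obtain B where B: "\<And>y. \<bar>u y\<bar> \<le> B" using bcontfun_abs_bound[OF u] by blast
  have [measurable]: "u \<in> borel_measurable borel"
    using bcontfun_continuous[OF u] by (intro borel_measurable_continuous_onI)
  have c: "(\<lambda>n. u (Y n)) \<longlonglongrightarrow> u y" if "Y \<longlonglongrightarrow> y" for Y y
    using continuous_on_tendsto_compose[OF bcontfun_continuous[OF u, of UNIV] that] by simp
  have "(\<lambda>n. LINT y|lborel. indicator (- ball 0 r) y *\<^sub>R L_integrand k s u (X n) y) \<longlonglongrightarrow>
      (LINT y|lborel. indicator (- ball 0 r) y *\<^sub>R L_integrand k s u x y)"
  proof (rule integral_dominated_convergence[where w = "\<lambda>y. indicator (- ball 0 r) y *\<^sub>R ((4 * B) * j y)"])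
    show "integrable lborel (\<lambda>y. indicator (- ball 0 r) y *\<^sub>R ((4 * B) * j y))"
      using set_integrable_mult_right[OF jump_density_far_integrable[OF \<open>0 < r\<close>], of "4 * B"]
      by (simp add: set_integrable_def)
    show "AE y in lborel. (\<lambda>n. indicator (- ball 0 r) y *\<^sub>R L_integrand k s u (X n) y) \<longlonglongrightarrow>
        indicator (- ball 0 r) y *\<^sub>R L_integrand k s u x y"
      unfolding L_integrand_def by (intro AE_I2 tendsto_intros c X)
    show "AE y in lborel. norm (indicator (- ball 0 r) y *\<^sub>R L_integrand k s u (X n) y)
        \<le> indicator (- ball 0 r) y *\<^sub>R ((4 * B) * j y)" for n
    proof (intro AE_I2)
      fix y
      have "\<bar>u (X n + y) + u (X n - y) - 2 * u (X n)\<bar> \<le> 4 * B"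
        using B[of "X n + y"] B[of "X n - y"] B[of "X n"] by linarith
      then show "norm (indicator (- ball 0 r) y *\<^sub>R L_integrand k s u (X n) y)
          \<le> indicator (- ball 0 r) y *\<^sub>R ((4 * B) * j y)"
        using jump_density_nonneg[of y]
        by (auto simp: L_integrand_def abs_mult indicator_def intro!: mult_right_mono)
    qed
  qed auto
  then show ?thesis
    unfolding L_trunc_def set_lebesgue_integral_def by (intro tendsto_intros)
qed

end

section \<open>Testing with quadratic polynomials\<close>

lemma eventually_at_right_ball_subset:
  fixes x :: "'a::metric_space"
  assumes "\<forall>\<^sub>F y in nhds x. P y"
  shows "\<forall>\<^sub>F r in at_right 0. \<forall>y\<in>ball x r. P y"
proof -
  obtain d where d: "0 < d" "\<And>y. dist y x < d \<Longrightarrow> P y"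
    using assms unfolding eventually_nhds_metric by auto
  have "\<forall>\<^sub>F r in at_right 0. r < d"
    using d(1) by (auto simp: eventually_at_right_field)
  then show ?thesis
    by eventually_elim (auto simp: dist_commute intro!: d(2))
qed

text \<open>Quadratic polynomials are the only test functions that the argument feeds into the definition of
  viscosity solutions.\<close>

lemma C2_on_quadratic:
  fixes p x :: "'a::euclidean_space"
  shows "C2_on S (\<lambda>y. c + p \<bullet> (y - x) + C * (norm (y - x))\<^sup>2)"
  unfolding C2_on_def
proof (intro exI[of _ "\<lambda>y. p + (2 * C) *\<^sub>R (y - x)"] exI[of _ "\<lambda>_. (2 * C) *\<^sub>R id_blinfun"] conjI ballI)
  fix y
  have *: "(\<lambda>y. c + p \<bullet> (y - x) + C * (norm (y - x))\<^sup>2) = (\<lambda>y. c + p \<bullet> (y - x) + C * ((y - x) \<bullet> (y - x)))"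
    by (simp add: power2_norm_eq_inner)
  show "((\<lambda>y. c + p \<bullet> (y - x) + C * (norm (y - x))\<^sup>2) has_derivative
      (\<lambda>h. (p + (2 * C) *\<^sub>R (y - x)) \<bullet> h)) (at y)"
    unfolding * by (auto intro!: derivative_eq_intros simp: algebra_simps inner_commute)
  show "((\<lambda>y. p + (2 * C) *\<^sub>R (y - x)) has_derivative blinfun_apply ((2 * C) *\<^sub>R id_blinfun)) (at y)"
    by (auto intro!: derivative_eq_intros simp: scaleR_blinfun.rep_eq)
qed auto

text \<open>The inequality \<open>- L f \<le> g\<close> in \<open>D\<close>, required only at points where a quadratic polynomial touches
  \<open>f\<close> from above.  There a test function glued to \<open>f\<close> in a small ball differs from \<open>f\<close> under \<open>L\<close> only
  by the contribution of the ball, which vanishes in the limit.  The inequality thus speaks of \<open>f\<close>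
  itself, and the opening of the polynomial does not enter.  The term of order zero is part of \<open>g\<close>, so
  that sub- and supersolutions of different equations can be added.\<close>

definition punctual_subsolution ::
    "('a::euclidean_space \<Rightarrow> real) \<Rightarrow> real \<Rightarrow> 'a set \<Rightarrow> ('a \<Rightarrow> real) \<Rightarrow> ('a \<Rightarrow> real) \<Rightarrow> bool" where
  "punctual_subsolution k s D g f \<longleftrightarrow>
     (\<forall>x\<in>D. \<forall>p C. (\<forall>\<^sub>F y in nhds x. f y \<le> f x + p \<bullet> (y - x) + C * (norm (y - x))\<^sup>2) \<longrightarrow>
        (\<forall>e>0. \<forall>\<^sub>F \<rho> in at_right 0. - g x \<le> L_trunc k s \<rho> f x + e))"

lemma L_integrand_cmult: "L_integrand k s (\<lambda>x. c * u x) x y = c * L_integrand k s u x y"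
  by (simp add: L_integrand_def algebra_simps)

lemma L_trunc_cmult: "L_trunc k s \<rho> (\<lambda>x. c * u x) x = c * L_trunc k s \<rho> u x"
  by (simp add: L_trunc_def L_integrand_cmult)

context stable_kernel
begin

text \<open>The second difference of a quadratic polynomial at its base point is \<open>2 * C * (norm y)\<^sup>2\<close>,
  whatever its gradient.\<close>

lemma glue_quadratic:
  fixes p x :: 'a and C r :: real
  assumes u: "u \<in> bcontfun" and r: "0 < r"
  defines "\<Phi> \<equiv> glue (\<lambda>y. u x + p \<bullet> (y - x) + C * (norm (y - x))\<^sup>2) u x r"
  shows "integrable lborel (L_integrand k s \<Phi> x)"
    and "L_op k s \<Phi> x = C * (LINT y:ball 0 r|lborel. norm y powr 2 * j y) + L_trunc k s r u x"
proof -
  obtain B where B: "\<And>y. \<bar>u y\<bar> \<le> B" using bcontfun_abs_bound[OF u] by blast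
  have [measurable]: "u \<in> borel_measurable borel"
    using bcontfun_continuous[OF u] by (intro borel_measurable_continuous_onI)
  have meas: "\<Phi> \<in> borel_measurable borel"
    unfolding \<Phi>_def glue_def by measurable
  have bd: "\<bar>\<Phi> y\<bar> \<le> B + norm p * r + \<bar>C\<bar> * r\<^sup>2" for y
  proof (cases "y \<in> ball x r")
    case True
    then have n: "norm (y - x) \<le> r" by (simp add: dist_norm norm_minus_commute)
    have 1: "\<bar>p \<bullet> (y - x)\<bar> \<le> norm p * r"
      using n by (intro order_trans[OF Cauchy_Schwarz_ineq2] mult_left_mono) auto
    have 2: "\<bar>C * (norm (y - x))\<^sup>2\<bar> \<le> \<bar>C\<bar> * r\<^sup>2"
      using n by (auto simp: abs_mult intro!: mult_left_mono power_mono)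
    show ?thesis
      using 1 2 B[of x] True by (simp add: \<Phi>_def glue_def)
  next
    case False
    have "0 \<le> norm p * r + \<bar>C\<bar> * r\<^sup>2" using r by simp
    then show ?thesis using False B[of y] by (simp add: \<Phi>_def glue_def)
  qed
  have near: "\<Phi> (x + y) + \<Phi> (x - y) - 2 * \<Phi> x = 2 * C * norm y powr 2" if "norm y < r" for y
    using that r by (simp add: \<Phi>_def glue_def dist_norm inner_minus_right)
  show int: "integrable lborel (L_integrand k s \<Phi> x)"
    using near r s by (intro L_integrand_integrable_of_second_difference[OF meas bd, of r 2 x "2 * \<bar>C\<bar>"])
      (auto simp: abs_mult)
  have "(LINT y:ball 0 r|lborel. L_integrand k s \<Phi> x y) = (LINT y:ball 0 r|lborel. (2 * C) * (norm y powr 2 * j y))"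
    by (intro set_lebesgue_integral_cong) (auto simp: L_integrand_def near)
  moreover have "(LINT y:- ball 0 r|lborel. L_integrand k s \<Phi> x y) = (LINT y:- ball 0 r|lborel. L_integrand k s u x y)"
    using r by (intro set_lebesgue_integral_cong) (auto simp: L_integrand_def \<Phi>_def glue_def dist_norm)
  then have "L_trunc k s r \<Phi> x = L_trunc k s r u x"
    by (simp add: L_trunc_def)
  ultimately show "L_op k s \<Phi> x = C * (LINT y:ball 0 r|lborel. norm y powr 2 * j y) + L_trunc k s r u x"
    using L_op_split[OF int, of r] by simp
qed

lemma glue_quadratic_L_op_near_L_trunc:
  assumes u: "u \<in> bcontfun" and e: "0 < e"
  shows "\<forall>\<^sub>F r in at_right 0.
    \<bar>L_op k s (glue (\<lambda>y. u x + p \<bullet> (y - x) + C * (norm (y - x))\<^sup>2) u x r) x - L_trunc k s r u x\<bar> < e"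
proof -
  have "((\<lambda>r. C * (LINT y:ball 0 r|lborel. norm y powr 2 * j y)) \<longlongrightarrow> C * 0) (at_right 0)"
    using s by (intro tendsto_mult_left set_integral_ball_tendsto_0[of 1] jump_density_near_integrable) auto
  then have "\<forall>\<^sub>F r in at_right 0. \<bar>C * (LINT y:ball 0 r|lborel. norm y powr 2 * j y)\<bar> < e"
    using e by (auto simp: tendsto_iff dist_real_def)
  moreover have "\<forall>\<^sub>F r::real in at_right 0. 0 < r"
    by (rule eventually_at_right_less)
  ultimately show ?thesis
    by eventually_elim (simp add: glue_quadratic(2)[OF u])
qed

text \<open>Adding \<open>(norm (y - x))\<^sup>2\<close> to the touching polynomial makes the contact strict, as the definition of
  viscosity solutions demands; the larger opening does no harm when the ball shrinks.\<close>

lemma viscosity_subsolution_punctual: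
  assumes D: "open D" and sub: "viscosity_subsolution k s D V h u"
  shows "punctual_subsolution k s D (\<lambda>x. h x - V x * u x) u"
  unfolding punctual_subsolution_def
proof (intro ballI allI impI)
  fix x p C and e :: real
  assume x: "x \<in> D" and e: "0 < e"
    and touch: "\<forall>\<^sub>F y in nhds x. u y \<le> u x + p \<bullet> (y - x) + C * (norm (y - x))\<^sup>2"
  have u: "u \<in> bcontfun" using sub by (simp add: viscosity_subsolution_def)
  let ?\<phi> = "\<lambda>y. u x + p \<bullet> (y - x) + (C + 1) * (norm (y - x))\<^sup>2"
  have "\<forall>\<^sub>F r in at_right 0. \<forall>y\<in>ball x r. y \<in> D \<and> u y \<le> u x + p \<bullet> (y - x) + C * (norm (y - x))\<^sup>2"
    using touch D x by (intro eventually_at_right_ball_subset eventually_conj eventually_nhds_in_open)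
  moreover have "\<forall>\<^sub>F r::real in at_right 0. 0 < r"
    by (rule eventually_at_right_less)
  ultimately show "\<forall>\<^sub>F \<rho> in at_right 0. - (h x - V x * u x) \<le> L_trunc k s \<rho> u x + e"
    using glue_quadratic_L_op_near_L_trunc[OF u e, of x p "C + 1"]
  proof eventually_elim
    case (elim r)
    have "u y < ?\<phi> y" if "y \<in> ball x r - {x}" for y
    proof -
      have "0 < (norm (y - x))\<^sup>2" using that by simp
      moreover have "u y \<le> u x + p \<bullet> (y - x) + C * (norm (y - x))\<^sup>2"
        using that elim(1) by blast
      moreover have "(C + 1) * (norm (y - x))\<^sup>2 = C * (norm (y - x))\<^sup>2 + (norm (y - x))\<^sup>2"
        by (simp add: algebra_simps)
      ultimately show ?thesis by linarith
    qed
    moreover have "ball x r \<subseteq> D" using elim(1) by blast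
    ultimately have "- L_op k s (glue ?\<phi> u x r) x + V x * u x \<le> h x"
      using sub[unfolded viscosity_subsolution_def, THEN conjunct2, rule_format, OF x elim(2), of ?\<phi>]
        C2_on_quadratic[of D "u x" p x "C + 1"] glue_quadratic(1)[OF u elim(2), of x p "C + 1"] by simp
    then show ?case using elim(3) by linarith
  qed
qed

text \<open>The negative of a supersolution is a subsolution of the equation with reversed signs, since \<open>L\<close> is
  linear.\<close>

lemma viscosity_supersolution_punctual:
  assumes D: "open D" and sup: "viscosity_supersolution k s D V h u"
  shows "punctual_subsolution k s D (\<lambda>x. V x * u x - h x) (\<lambda>x. - u x)"
  unfolding punctual_subsolution_def
proof (intro ballI allI impI)
  fix x p C and e :: real
  assume x: "x \<in> D" and e: "0 < e"
    and touch: "\<forall>\<^sub>F y in nhds x. - u y \<le> - u x + p \<bullet> (y - x) + C * (norm (y - x))\<^sup>2"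
  have u: "u \<in> bcontfun" using sup by (simp add: viscosity_supersolution_def)
  let ?\<phi> = "\<lambda>y. u x + (- p) \<bullet> (y - x) + (- C - 1) * (norm (y - x))\<^sup>2"
  have "\<forall>\<^sub>F r in at_right 0. \<forall>y\<in>ball x r. y \<in> D \<and> - u y \<le> - u x + p \<bullet> (y - x) + C * (norm (y - x))\<^sup>2"
    using touch D x by (intro eventually_at_right_ball_subset eventually_conj eventually_nhds_in_open)
  moreover have "\<forall>\<^sub>F r::real in at_right 0. 0 < r"
    by (rule eventually_at_right_less)
  ultimately show "\<forall>\<^sub>F \<rho> in at_right 0. - (V x * u x - h x) \<le> L_trunc k s \<rho> (\<lambda>x. - u x) x + e"
    using glue_quadratic_L_op_near_L_trunc[OF u e, of x "- p" "- C - 1"]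
  proof eventually_elim
    case (elim r)
    have "?\<phi> y < u y" if "y \<in> ball x r - {x}" for y
    proof -
      have "0 < (norm (y - x))\<^sup>2" using that by simp
      moreover have "- u y \<le> - u x + p \<bullet> (y - x) + C * (norm (y - x))\<^sup>2"
        using that elim(1) by blast
      moreover have "(- C - 1) * (norm (y - x))\<^sup>2 = - (C * (norm (y - x))\<^sup>2) - (norm (y - x))\<^sup>2"
        by (simp add: algebra_simps)
      moreover have "(- p) \<bullet> (y - x) = - (p \<bullet> (y - x))" by simp
      ultimately show ?thesis by linarith
    qed
    moreover have "ball x r \<subseteq> D" using elim(1) by blast
    ultimately have "- L_op k s (glue ?\<phi> u x r) x + V x * u x \<ge> h x"
      using sup[unfolded viscosity_supersolution_def, THEN conjunct2, rule_format, OF x elim(2), of ?\<phi>]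
        C2_on_quadratic[of D "u x" "- p" x "- C - 1"] glue_quadratic(1)[OF u elim(2), of x "- p" "- C - 1"] by simp
    moreover have "L_trunc k s r (\<lambda>x. - u x) x = - L_trunc k s r u x"
      using L_trunc_cmult[of k s r "-1" u x] by simp
    ultimately show ?case using elim(3) by linarith
  qed
qed

text \<open>Where \<open>L \<psi>\<close> converges, it is the limit of the truncated operators, so a pointwise inequality passes
  to the punctual one at every point.  This puts \<open>- t \<psi>\<close>, although \<open>\<psi>\<close> may have no second derivatives, on the
  same footing as \<open>u\<close> and \<open>- v\<close>.\<close>

lemma classical_supersolution_punctual:
  assumes int: "\<And>x. x \<in> D \<Longrightarrow> integrable lborel (L_integrand k s \<psi> x)"
    and sup: "\<And>x. x \<in> D \<Longrightarrow> L_op k s \<psi> x \<le> c x"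
    and t: "0 \<le> t"
  shows "punctual_subsolution k s D (\<lambda>x. t * c x) (\<lambda>x. - t * \<psi> x)"
  unfolding punctual_subsolution_def
proof (intro ballI allI impI)
  fix x and e :: real
  assume x: "x \<in> D" and e: "0 < e"
  have "((\<lambda>\<rho>. L_trunc k s \<rho> (\<lambda>x. - t * \<psi> x) x) \<longlongrightarrow> - t * L_op k s \<psi> x) (at_right 0)"
    unfolding L_trunc_cmult by (intro tendsto_mult_left L_trunc_tendsto_L_op int x)
  moreover have "- (t * c x) - e < - t * L_op k s \<psi> x"
    using mult_left_mono[OF sup[OF x] t] e by simp
  ultimately have "\<forall>\<^sub>F \<rho> in at_right 0. - (t * c x) - e < L_trunc k s \<rho> (\<lambda>x. - t * \<psi> x) x"
    by (rule order_tendstoD(1))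
  then show "\<forall>\<^sub>F \<rho> in at_right 0. - (t * c x) \<le> L_trunc k s \<rho> (\<lambda>x. - t * \<psi> x) x + e"
    by eventually_elim simp
qed

end

section \<open>Sums of subsolutions\<close>

lemma norm_add_power2:
  fixes a h :: "'a::real_inner"
  shows "(norm (a + h))\<^sup>2 = (norm a)\<^sup>2 + 2 * (a \<bullet> h) + (norm h)\<^sup>2"
  by (simp add: power2_norm_eq_inner inner_simps inner_commute)

context stable_kernel
begin

lemma L_trunc_add:
  assumes "u \<in> bcontfun" "v \<in> bcontfun" "0 < \<rho>"
  shows "L_trunc k s \<rho> (\<lambda>x. u x + v x) x = L_trunc k s \<rho> u x + L_trunc k s \<rho> v x"
proof -
  have "(LINT y:- ball 0 \<rho>|lborel. L_integrand k s (\<lambda>x. u x + v x) x y) =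
      (LINT y:- ball 0 \<rho>|lborel. L_integrand k s u x y + L_integrand k s v x y)"
    by (simp add: L_integrand_def algebra_simps)
  also have "\<dots> = (LINT y:- ball 0 \<rho>|lborel. L_integrand k s u x y) + (LINT y:- ball 0 \<rho>|lborel. L_integrand k s v x y)"
    by (intro set_integral_add L_integrand_far_integrable_bcontfun assms)
  finally show ?thesis by (simp add: L_trunc_def)
qed

text \<open>A change of the truncation radius from \<open>r\<close> to \<open>\<rho>\<close> costs an amount independent of \<open>r\<close>, if
  the sum of the two second differences is at most quadratic; neither of them alone has to be.\<close>

lemma L_trunc_pair_le:
  assumes u: "u \<in> bcontfun" and v: "v \<in> bcontfun" and r: "0 < r" "r \<le> \<rho>" and c: "0 \<le> c"
    and diff: "\<And>h. norm h < \<rho> \<Longrightarrow>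
      (u (x + h) + u (x - h) - 2 * u x) + (v (y + h) + v (y - h) - 2 * v y) \<le> 2 * c * (norm h)\<^sup>2"
  shows "L_trunc k s r u x + L_trunc k s r v y \<le>
    L_trunc k s \<rho> u x + L_trunc k s \<rho> v y + c * (LINT h:ball 0 \<rho>|lborel. norm h powr 2 * j h)"
proof -
  define S where "S h = L_integrand k s u x h + L_integrand k s v y h" for h
  have sum: "L_trunc k s t u x + L_trunc k s t v y = (1/2) * (LINT h:- ball 0 t|lborel. S h)"
    and iS: "set_integrable lborel (- ball 0 t) S" if "0 < t" for t
    unfolding L_trunc_def S_def using that
    by (auto simp: L_integrand_far_integrable_bcontfun[OF u] L_integrand_far_integrable_bcontfun[OF v] algebra_simps)
  have iN: "set_integrable lborel (ball 0 \<rho>) (\<lambda>h. (2 * c) * (norm h powr 2 * j h))"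
    using s r by (intro set_integrable_mult_right jump_density_near_integrable) auto
  have "(LINT h:- ball 0 r|lborel. S h) \<le> (LINT h|lborel. indicator (- ball 0 \<rho>) h *\<^sub>R S h
      + indicator (ball 0 \<rho>) h *\<^sub>R ((2 * c) * (norm h powr 2 * j h)))"
    unfolding set_lebesgue_integral_def
  proof (rule integral_mono)
    fix h
    have "S h \<le> (2 * c) * (norm h powr 2 * j h)" if "norm h < \<rho>"
    proof (cases "h = 0")
      case False
      have "S h = ((u (x + h) + u (x - h) - 2 * u x) + (v (y + h) + v (y - h) - 2 * v y)) * j h"
        by (simp add: S_def L_integrand_def algebra_simps)
      also have "\<dots> \<le> 2 * c * (norm h)\<^sup>2 * j h"
        by (intro mult_right_mono diff that jump_density_nonneg)
      finally show ?thesis using False by (simp add: mult_ac)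
    qed (simp add: S_def L_integrand_def)
    moreover have "0 \<le> (2 * c) * (norm h powr 2 * j h)"
      using c jump_density_nonneg[of h] by simp
    ultimately show "indicator (- ball 0 r) h *\<^sub>R S h \<le> indicator (- ball 0 \<rho>) h *\<^sub>R S h
      + indicator (ball 0 \<rho>) h *\<^sub>R ((2 * c) * (norm h powr 2 * j h))"
      using r by (auto simp: indicator_def)
  qed (use iS[of r] iS[of \<rho>] iN r in \<open>auto simp: set_integrable_def\<close>)
  also have "\<dots> = (LINT h:- ball 0 \<rho>|lborel. S h) + 2 * c * (LINT h:ball 0 \<rho>|lborel. norm h powr 2 * j h)"
    using iS[of \<rho>] iN r unfolding set_lebesgue_integral_def set_integrable_def
    by (subst Bochner_Integration.integral_add) (auto simp: mult.assoc mult.left_commute[of "indicator _ _"])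
  finally show ?thesis using r by (simp add: sum)
qed

text \<open>Doubling of variables.  If \<open>f1 + f2\<close> is touched from above at \<open>x0\<close> by the polynomial \<open>q\<close>, the
  maximum points \<open>(X n, Y n)\<close> of \<open>f1 x + f2 y - q x - n * (norm (x - y))\<^sup>2\<close> converge to
  \<open>(x0, x0)\<close>, and \<open>f1\<close>, \<open>f2\<close> are separately touched there by quadratic polynomials.  Their openings grow
  with \<open>n\<close>, but for fixed \<open>n\<close> they disappear from the inequalities as the truncation radius \<open>r\<close>
  tends to \<open>0\<close>.  Comparing the maximum with the values at the shifted points
  \<open>(X n + h, Y n + h)\<close>, where the penalty is unchanged, bounds the sum of the second differences by
  that of \<open>q\<close>.  This permits raising the radius to a \<open>\<rho>\<close> independent of \<open>n\<close>, after which \<open>n\<close> can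
  tend to infinity.\<close>

lemma punctual_subsolution_add:
  assumes D: "open D" and bc: "f1 \<in> bcontfun" "f2 \<in> bcontfun"
    and g: "continuous_on D g1" "continuous_on D g2"
    and sub: "punctual_subsolution k s D g1 f1" "punctual_subsolution k s D g2 f2"
  shows "punctual_subsolution k s D (\<lambda>x. g1 x + g2 x) (\<lambda>x. f1 x + f2 x)"
  unfolding punctual_subsolution_def
proof (intro ballI allI impI)
  fix x0 p C0 and e :: real
  assume x0: "x0 \<in> D" and e: "0 < e"
    and touch: "\<forall>\<^sub>F y in nhds x0. f1 y + f2 y \<le> f1 x0 + f2 x0 + p \<bullet> (y - x0) + C0 * (norm (y - x0))\<^sup>2"
  \<comment> \<open>The absolute value keeps \<open>q\<close> convex, and the summand \<open>1\<close> makes the contact at \<open>x0\<close> strict.\<close>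
  define c where "c = \<bar>C0\<bar> + 1"
  define q where "q z = f1 x0 + f2 x0 + p \<bullet> (z - x0) + c * (norm (z - x0))\<^sup>2" for z
  have q_shift: "q (z + h) = q z + (p + (2 * c) *\<^sub>R (z - x0)) \<bullet> h + c * (norm h)\<^sup>2" for z h
  proof -
    have "z + h - x0 = (z - x0) + h" by simp
    then show ?thesis
      unfolding q_def by (simp only: norm_add_power2) (simp add: algebra_simps inner_simps)
  qed
  have q_cont: "continuous_on A q" for A
    unfolding q_def by (intro continuous_intros)
  have cont: "continuous_on A f1" "continuous_on A f2" for A
    using bc by (auto intro: bcontfun_continuous)
  have "\<forall>\<^sub>F y in nhds x0. y \<in> D \<and> f1 y + f2 y \<le> f1 x0 + f2 x0 + p \<bullet> (y - x0) + C0 * (norm (y - x0))\<^sup>2"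
    using touch D x0 by (intro eventually_conj eventually_nhds_in_open)
  then obtain d where d: "0 < d" and d': "\<And>y. dist y x0 < d \<Longrightarrow> y \<in> D \<and>
      f1 y + f2 y \<le> f1 x0 + f2 x0 + p \<bullet> (y - x0) + C0 * (norm (y - x0))\<^sup>2"
    unfolding eventually_nhds_metric by auto
  define R where "R = d / 2"
  have R: "0 < R" using d by (simp add: R_def)
  define K where "K = cball x0 R"
  have K: "compact K" "x0 \<in> K" "K \<subseteq> D"
    using R d d' by (auto simp: K_def R_def dist_commute)
  have touchK: "f1 y + f2 y \<le> q y - (norm (y - x0))\<^sup>2" if "y \<in> K" for y
  proof -
    have "dist y x0 < d" using that d by (simp add: K_def R_def dist_commute)
    then have "f1 y + f2 y \<le> f1 x0 + f2 x0 + p \<bullet> (y - x0) + C0 * (norm (y - x0))\<^sup>2"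
      using d' by blast
    moreover have "C0 * (norm (y - x0))\<^sup>2 \<le> \<bar>C0\<bar> * (norm (y - x0))\<^sup>2"
      by (intro mult_right_mono) auto
    moreover have "c * (norm (y - x0))\<^sup>2 = \<bar>C0\<bar> * (norm (y - x0))\<^sup>2 + (norm (y - x0))\<^sup>2"
      by (simp add: c_def algebra_simps)
    ultimately show "f1 y + f2 y \<le> q y - (norm (y - x0))\<^sup>2"
      unfolding q_def by linarith
  qed
  define \<Phi> where "\<Phi> n x y = f1 x + f2 y - q x - real n * (norm (x - y))\<^sup>2" for n x y
  have "\<exists>z\<in>K \<times> K. \<forall>w\<in>K \<times> K. \<Phi> n (fst w) (snd w) \<le> \<Phi> n (fst z) (snd z)" for n
    unfolding \<Phi>_def using K
    by (intro continuous_attains_sup compact_Times continuous_intros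
        continuous_on_compose2[OF cont(1)[of UNIV]] continuous_on_compose2[OF cont(2)[of UNIV]]
        continuous_on_compose2[OF q_cont[of UNIV]]) auto
  then obtain Z where Z: "\<And>n. Z n \<in> K \<times> K"
      "\<And>n w. w \<in> K \<times> K \<Longrightarrow> \<Phi> n (fst w) (snd w) \<le> \<Phi> n (fst (Z n)) (snd (Z n))"
    by metis
  define X where "X n = fst (Z n)" for n
  define Y where "Y n = snd (Z n)" for n
  have XK: "X n \<in> K" and YK: "Y n \<in> K" for n
    using Z(1)[of n] by (auto simp: X_def Y_def mem_Times_iff)
  have max: "\<Phi> n x y \<le> \<Phi> n (X n) (Y n)" if "x \<in> K" "y \<in> K" for n x y
    using Z(2)[of "(x, y)" n] that by (simp add: X_def Y_def)
  have pos: "0 \<le> \<Phi> n (X n) (Y n)" for n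
    using max[OF K(2) K(2), of n] by (simp add: \<Phi>_def q_def)
  have XY: "(\<lambda>n. dist (X n) (Y n)) \<longlonglongrightarrow> 0"
  proof -
    have "\<exists>M. \<forall>x\<in>K. \<bar>f x\<bar> \<le> M" if "continuous_on K f" for f :: "'a \<Rightarrow> real"
      using compact_imp_bounded[OF compact_continuous_image[OF that K(1)]] by (auto simp: bounded_iff)
    then obtain M1 M2 M3 where M: "\<And>x. x \<in> K \<Longrightarrow> \<bar>f1 x\<bar> \<le> M1" "\<And>x. x \<in> K \<Longrightarrow> \<bar>f2 x\<bar> \<le> M2"
        "\<And>x. x \<in> K \<Longrightarrow> \<bar>q x\<bar> \<le> M3"
      using cont q_cont by metis
    have bd: "(norm (X n - Y n))\<^sup>2 \<le> (M1 + M2 + M3) / real n" if "0 < n" for n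
    proof -
      have "real n * (norm (X n - Y n))\<^sup>2 \<le> M1 + M2 + M3"
        using pos[of n] M(1)[OF XK[of n]] M(2)[OF YK[of n]] M(3)[OF XK[of n]] by (simp add: \<Phi>_def)
      then show ?thesis using that by (simp add: field_simps)
    qed
    have "(\<lambda>n. (norm (X n - Y n))\<^sup>2) \<longlonglongrightarrow> 0"
    proof (rule tendsto_sandwich[OF _ _ tendsto_const])
      show "\<forall>\<^sub>F n in sequentially. (norm (X n - Y n))\<^sup>2 \<le> (M1 + M2 + M3) / real n"
        using eventually_gt_at_top[of 0] by eventually_elim (rule bd)
      show "(\<lambda>n. (M1 + M2 + M3) / real n) \<longlonglongrightarrow> 0"
        by (rule lim_const_over_n)
    qed auto
    then have "(\<lambda>n. sqrt ((norm (X n - Y n))\<^sup>2)) \<longlonglongrightarrow> sqrt 0"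
      by (rule tendsto_real_sqrt)
    then show ?thesis by (simp add: dist_norm)
  qed
  have "uniformly_continuous_on K f2"
    by (intro compact_uniformly_continuous cont K)
  then have f2XY: "(\<lambda>n. dist (f2 (X n)) (f2 (Y n))) \<longlonglongrightarrow> 0"
    using XK YK XY unfolding uniformly_continuous_on_sequentially by blast
  have X0: "X \<longlonglongrightarrow> x0"
  proof -
    have "(\<lambda>n. (norm (X n - x0))\<^sup>2) \<longlonglongrightarrow> 0"
    proof (rule tendsto_sandwich[OF _ _ tendsto_const f2XY])
      \<comment> \<open>Strictness of the contact: a nonnegative value at the maximum forces \<open>X n\<close> towards \<open>x0\<close>.\<close>
      have "(norm (X n - x0))\<^sup>2 \<le> dist (f2 (X n)) (f2 (Y n))" for n
      proof -
        have "0 \<le> real n * (norm (X n - Y n))\<^sup>2" by simp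
        then show ?thesis
          using pos[of n] touchK[OF XK[of n]] unfolding \<Phi>_def dist_real_def by linarith
      qed
      then show "\<forall>\<^sub>F n in sequentially. (norm (X n - x0))\<^sup>2 \<le> dist (f2 (X n)) (f2 (Y n))"
        by simp
    qed auto
    then have "(\<lambda>n. sqrt ((norm (X n - x0))\<^sup>2)) \<longlonglongrightarrow> sqrt 0"
      by (rule tendsto_real_sqrt)
    then show ?thesis by (simp add: tendsto_iff dist_norm)
  qed
  have Y0: "Y \<longlonglongrightarrow> x0"
  proof -
    have "(\<lambda>n. X n - Y n) \<longlonglongrightarrow> 0"
      using XY by (simp add: dist_norm tendsto_norm_zero_iff)
    from tendsto_diff[OF X0 this] show ?thesis by simp
  qed
  define \<kappa> where "\<kappa> r = (LINT h:ball 0 r|lborel. norm h powr 2 * j (h::'a))" for r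
  have "((\<lambda>r. c * \<kappa> r) \<longlongrightarrow> c * 0) (at_right 0)"
    unfolding \<kappa>_def using s
    by (intro tendsto_mult_left set_integral_ball_tendsto_0[of 1] jump_density_near_integrable) auto
  then have "\<forall>\<^sub>F r in at_right 0. c * \<kappa> r < e / 2"
    using e by (intro order_tendstoD(2)) auto
  moreover have "\<forall>\<^sub>F r in at_right 0. 0 < r \<and> r < R / 2"
    using eventually_at_right_real[of 0 "R / 2"] R by simp
  ultimately show "\<forall>\<^sub>F \<rho> in at_right 0. - (g1 x0 + g2 x0) \<le> L_trunc k s \<rho> (\<lambda>x. f1 x + f2 x) x0 + e"
  proof eventually_elim
    case (elim \<rho>)
    have "\<forall>\<^sub>F n in sequentially. X n \<in> ball x0 (R/2) \<and> Y n \<in> ball x0 (R/2)"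
      using R by (intro eventually_conj topological_tendstoD[OF X0] topological_tendstoD[OF Y0]) auto
    then have "\<forall>\<^sub>F n in sequentially. - (g1 (X n) + g2 (Y n)) \<le> L_trunc k s \<rho> f1 (X n) + L_trunc k s \<rho> f2 (Y n) + e"
    proof eventually_elim
      case (elim n)
      have nb: "X n + h \<in> K" "Y n + h \<in> K" if "norm h < R / 2" for h
      proof -
        have "norm (X n - x0) < R/2" "norm (Y n - x0) < R/2"
          using elim by (auto simp: dist_norm norm_minus_commute)
        then have "norm (X n - x0 + h) \<le> R" "norm (Y n - x0 + h) \<le> R"
          using that norm_triangle_ineq[of "X n - x0" h] norm_triangle_ineq[of "Y n - x0" h] by linarith+
        then show "X n + h \<in> K" "Y n + h \<in> K"
          by (simp_all add: K_def dist_norm norm_minus_commute add_diff_eq diff_add_eq)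
      qed
      have ev: "\<forall>\<^sub>F y in nhds z. norm (y - z) < R / 2" for z :: 'a
        using R by (auto simp: eventually_nhds_metric dist_norm intro!: exI[of _ "R / 2"])
      have "\<forall>\<^sub>F y in nhds (X n). f1 y \<le> f1 (X n)
          + (p + (2 * c) *\<^sub>R (X n - x0) + (2 * real n) *\<^sub>R (X n - Y n)) \<bullet> (y - X n) + (c + real n) * (norm (y - X n))\<^sup>2"
        using ev[of "X n"]
      proof eventually_elim
        case (elim y)
        define h where "h = y - X n"
        have h: "norm h < R / 2" using elim by (simp add: h_def)
        have "(norm (X n + h - Y n))\<^sup>2 = (norm (X n - Y n))\<^sup>2 + 2 * ((X n - Y n) \<bullet> h) + (norm h)\<^sup>2"
          using norm_add_power2[of "X n - Y n" h] by (simp add: algebra_simps)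
        then have "f1 (X n + h) \<le> f1 (X n) + (p + (2 * c) *\<^sub>R (X n - x0)) \<bullet> h + c * (norm h)\<^sup>2
            + real n * (2 * ((X n - Y n) \<bullet> h) + (norm h)\<^sup>2)"
          using max[OF nb(1)[OF h] YK[of n], of n] unfolding \<Phi>_def q_shift by (simp only: distrib_left distrib_right)
        then show ?case
          by (simp add: h_def algebra_simps inner_simps)
      qed
      then have 1: "\<forall>\<^sub>F r in at_right 0. - g1 (X n) \<le> L_trunc k s r f1 (X n) + e / 4"
        using sub(1) XK[of n] K(3) e unfolding punctual_subsolution_def by (meson divide_pos_pos subsetD zero_less_numeral)
      have "\<forall>\<^sub>F y in nhds (Y n). f2 y \<le> f2 (Y n)
          + ((2 * real n) *\<^sub>R (Y n - X n)) \<bullet> (y - Y n) + real n * (norm (y - Y n))\<^sup>2"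
        using ev[of "Y n"]
      proof eventually_elim
        case (elim y)
        define h where "h = y - Y n"
        have h: "norm h < R / 2" using elim by (simp add: h_def)
        have "(norm (X n - (Y n + h)))\<^sup>2 = (norm (X n - Y n))\<^sup>2 + 2 * ((Y n - X n) \<bullet> h) + (norm h)\<^sup>2"
          using norm_add_power2[of "Y n - X n" h] by (simp add: algebra_simps norm_minus_commute)
        then have "f2 (Y n + h) \<le> f2 (Y n) + real n * (2 * ((Y n - X n) \<bullet> h) + (norm h)\<^sup>2)"
          using max[OF XK[of n] nb(2)[OF h], of n] unfolding \<Phi>_def by (simp only: distrib_left distrib_right)
        then show ?case
          by (simp add: h_def algebra_simps inner_simps)
      qed
      then have 2: "\<forall>\<^sub>F r in at_right 0. - g2 (Y n) \<le> L_trunc k s r f2 (Y n) + e / 4"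
        using sub(2) YK[of n] K(3) e unfolding punctual_subsolution_def by (meson divide_pos_pos subsetD zero_less_numeral)
      have "\<forall>\<^sub>F r in at_right 0. 0 < r \<and> r < \<rho>"
        using eventually_at_right_real[of 0 \<rho>] \<open>0 < \<rho> \<and> \<rho> < R / 2\<close> by simp
      \<comment> \<open>The radius \<open>r\<close> depends on \<open>n\<close> and only serves to reach the fixed radius \<open>\<rho>\<close>.\<close>
      from eventually_happens'[OF _ eventually_conj[OF this eventually_conj[OF 1 2]]]
      obtain r where r: "0 < r" "r < \<rho>" "- g1 (X n) \<le> L_trunc k s r f1 (X n) + e / 4"
          "- g2 (Y n) \<le> L_trunc k s r f2 (Y n) + e / 4"
        by auto
      have "L_trunc k s r f1 (X n) + L_trunc k s r f2 (Y n) \<le>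
          L_trunc k s \<rho> f1 (X n) + L_trunc k s \<rho> f2 (Y n) + c * \<kappa> \<rho>"
        unfolding \<kappa>_def
      proof (rule L_trunc_pair_le[OF bc])
        fix h :: 'a assume "norm h < \<rho>"
        then have h: "norm h < R / 2" "norm (- h) < R / 2"
          using \<open>0 < \<rho> \<and> \<rho> < R / 2\<close> by auto
        have "f1 (X n + h) + f2 (Y n + h) - q (X n + h) \<le> f1 (X n) + f2 (Y n) - q (X n)"
             "f1 (X n + - h) + f2 (Y n + - h) - q (X n + - h) \<le> f1 (X n) + f2 (Y n) - q (X n)"
          using max[OF nb(1)[OF h(1)] nb(2)[OF h(1)], of n] max[OF nb(1)[OF h(2)] nb(2)[OF h(2)], of n]
          by (simp_all add: \<Phi>_def)
        then show "(f1 (X n + h) + f1 (X n - h) - 2 * f1 (X n)) + (f2 (Y n + h) + f2 (Y n - h) - 2 * f2 (Y n))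
            \<le> 2 * c * (norm h)\<^sup>2"
          unfolding q_shift by (simp add: inner_minus_right)
      qed (use r in \<open>auto simp: c_def\<close>)
      then show ?case
        using r \<open>c * \<kappa> \<rho> < e / 2\<close> by linarith
    qed
    moreover have "(\<lambda>n. - (g1 (X n) + g2 (Y n))) \<longlonglongrightarrow> - (g1 x0 + g2 x0)"
      using subsetD[OF K(3) XK] subsetD[OF K(3) YK]
      by (intro tendsto_intros continuous_on_tendsto_compose[OF g(1) X0] continuous_on_tendsto_compose[OF g(2) Y0] x0)
        simp_all
    moreover have "(\<lambda>n. L_trunc k s \<rho> f1 (X n) + L_trunc k s \<rho> f2 (Y n) + e) \<longlonglongrightarrow>
        L_trunc k s \<rho> f1 x0 + L_trunc k s \<rho> f2 x0 + e"
      using elim by (intro tendsto_intros L_trunc_tendsto bc X0 Y0) auto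
    ultimately have "- (g1 x0 + g2 x0) \<le> L_trunc k s \<rho> f1 x0 + L_trunc k s \<rho> f2 x0 + e"
      by (blast intro: tendsto_le[OF sequentially_bot])
    then show ?case
      using elim by (simp add: L_trunc_add[OF bc])
  qed
qed

end

section \<open>Second differences of functions of class \<open>C\<^sup>2\<^sup>s\<^sup>+\<close>\<close>

lemma C_hoelder_bounded: "C_hoelder m \<theta> S f \<Longrightarrow> bounded (f ` S)"
  by (cases m) auto

lemma C_hoelder_continuous_on: "C_hoelder m \<theta> S f \<Longrightarrow> continuous_on S f"
  by (cases m) (auto simp: continuous_on_eq_continuous_within intro: has_derivative_continuous)

lemma C_hoelder_Suc_Lipschitz:
  assumes f: "C_hoelder (Suc m) \<theta> S f" and S: "convex S"
  shows "\<exists>C. \<forall>x\<in>S. \<forall>y\<in>S. \<bar>f x - f y\<bar> \<le> C * norm (x - y)"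
proof -
  obtain g where g: "\<And>x. x \<in> S \<Longrightarrow> (f has_derivative (\<lambda>h. g x \<bullet> h)) (at x within S)"
    and gb: "\<And>b. b \<in> Basis \<Longrightarrow> C_hoelder m \<theta> S (\<lambda>x. g x \<bullet> b)"
    using f by auto
  have "\<forall>b\<in>Basis. \<exists>B. \<forall>x\<in>S. \<bar>g x \<bullet> b\<bar> \<le> B"
    using C_hoelder_bounded[OF gb] by (auto simp: bounded_iff)
  then obtain B where B: "\<And>b x. b \<in> Basis \<Longrightarrow> x \<in> S \<Longrightarrow> \<bar>g x \<bullet> b\<bar> \<le> B b"
    by metis
  have "onorm (\<lambda>h. g x \<bullet> h) \<le> (\<Sum>b\<in>Basis. B b)" if "x \<in> S" for x
  proof -
    have n: "norm (g x) \<le> (\<Sum>b\<in>Basis. B b)"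
      using B[OF _ that] by (intro order_trans[OF norm_le_l1] sum_mono) auto
    show ?thesis
    proof (rule onorm_bound)
      show "0 \<le> (\<Sum>b\<in>Basis. B b)" using n norm_ge_zero order_trans by blast
      show "norm (g x \<bullet> h) \<le> (\<Sum>b\<in>Basis. B b) * norm h" for h
        using Cauchy_Schwarz_ineq2[of "g x" h] mult_right_mono[OF n norm_ge_zero[of h]] by simp
    qed
  qed
  then have "norm (f x - f y) \<le> (\<Sum>b\<in>Basis. B b) * norm (x - y)" if "x \<in> S" "y \<in> S" for x y
    using that by (intro differentiable_bound[OF S g])
  then show ?thesis by auto
qed

text \<open>The derivative of \<open>f (x0 + \<tau> *\<^sub>R h) + f (x0 - \<tau> *\<^sub>R h)\<close> in \<open>\<tau>\<close> is a difference of gradients at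
  points of distance \<open>2 * \<tau> * norm h\<close>, in the direction \<open>h\<close>; the mean value theorem gains the power
  \<open>1 + \<theta>\<close>.\<close>

lemma second_difference_of_Hoelder_gradient:
  fixes f :: "'a::euclidean_space \<Rightarrow> real" and g :: "'a \<Rightarrow> 'a"
  assumes f: "\<And>x. x \<in> cball x0 r \<Longrightarrow> (f has_derivative (\<lambda>h. g x \<bullet> h)) (at x within cball x0 r)"
    and g: "\<And>b. b \<in> Basis \<Longrightarrow> \<exists>C. \<forall>x\<in>cball x0 r. \<forall>y\<in>cball x0 r. \<bar>g x \<bullet> b - g y \<bullet> b\<bar> \<le> C * norm (x - y) powr \<theta>"
    and \<theta>: "0 \<le> \<theta>"
  shows "\<exists>C. \<forall>h. norm h < r \<longrightarrow> \<bar>f (x0 + h) + f (x0 - h) - 2 * f x0\<bar> \<le> C * norm h powr (1 + \<theta>)"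
proof -
  obtain C where C: "\<And>b x y. b \<in> Basis \<Longrightarrow> x \<in> cball x0 r \<Longrightarrow> y \<in> cball x0 r \<Longrightarrow>
      \<bar>g x \<bullet> b - g y \<bullet> b\<bar> \<le> C b * norm (x - y) powr \<theta>"
    using g by metis
  define M where "M = (\<Sum>b\<in>(Basis::'a set). \<bar>C b\<bar>)"
  have M0: "0 \<le> M" by (simp add: M_def sum_nonneg)
  have gM: "\<bar>(g x - g y) \<bullet> h\<bar> \<le> M * norm (x - y) powr \<theta> * norm h"
    if "x \<in> cball x0 r" "y \<in> cball x0 r" for x y h
  proof -
    have "\<bar>(g x - g y) \<bullet> h\<bar> = \<bar>\<Sum>b\<in>Basis. ((g x - g y) \<bullet> b) * (h \<bullet> b)\<bar>"
      by (simp add: euclidean_inner[of "g x - g y" h])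
    also have "\<dots> \<le> (\<Sum>b\<in>Basis. \<bar>((g x - g y) \<bullet> b) * (h \<bullet> b)\<bar>)"
      by (rule sum_abs)
    also have "\<dots> \<le> (\<Sum>b\<in>Basis. \<bar>C b\<bar> * (norm (x - y) powr \<theta> * norm h))"
    proof (rule sum_mono)
      fix b :: 'a assume b: "b \<in> Basis"
      have "\<bar>(g x - g y) \<bullet> b\<bar> \<le> C b * norm (x - y) powr \<theta>"
        using C[OF b that] by (simp add: inner_diff_left)
      also have "\<dots> \<le> \<bar>C b\<bar> * norm (x - y) powr \<theta>"
        by (intro mult_right_mono) auto
      finally have "\<bar>(g x - g y) \<bullet> b\<bar> * \<bar>h \<bullet> b\<bar> \<le> (\<bar>C b\<bar> * norm (x - y) powr \<theta>) * norm h"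
        using b by (intro mult_mono Basis_le_norm) auto
      then show "\<bar>((g x - g y) \<bullet> b) * (h \<bullet> b)\<bar> \<le> \<bar>C b\<bar> * (norm (x - y) powr \<theta> * norm h)"
        by (simp add: abs_mult mult.assoc)
    qed
    finally show ?thesis by (simp add: M_def sum_distrib_right mult.assoc)
  qed
  have "\<bar>f (x0 + h) + f (x0 - h) - 2 * f x0\<bar> \<le> (M * 2 powr \<theta>) * norm h powr (1 + \<theta>)" if h: "norm h < r" for h
  proof -
    define F where "F \<tau> = f (x0 + \<tau> *\<^sub>R h) + f (x0 - \<tau> *\<^sub>R h)" for \<tau> :: real
    have seg: "x0 + \<tau> *\<^sub>R h \<in> cball x0 r" "x0 - \<tau> *\<^sub>R h \<in> cball x0 r" if "0 \<le> \<tau>" "\<tau> \<le> 1" for \<tau>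
    proof -
      have "\<tau> * norm h \<le> 1 * norm h" using that by (intro mult_right_mono) auto
      then show "x0 + \<tau> *\<^sub>R h \<in> cball x0 r" "x0 - \<tau> *\<^sub>R h \<in> cball x0 r"
        using that h by (auto simp: dist_norm)
    qed
    have 1: "((\<lambda>\<tau>. f (x0 + \<tau> *\<^sub>R h)) has_derivative (\<lambda>t. g (x0 + \<tau> *\<^sub>R h) \<bullet> (t *\<^sub>R h))) (at \<tau> within {0..1})"
      if "0 \<le> \<tau>" "\<tau> \<le> 1" for \<tau>
      by (rule has_derivative_in_compose[of "\<lambda>\<tau>. x0 + \<tau> *\<^sub>R h"])
        (use seg that in \<open>auto intro!: derivative_eq_intros has_derivative_subset[OF f]\<close>)
    have 2: "((\<lambda>\<tau>. f (x0 - \<tau> *\<^sub>R h)) has_derivative (\<lambda>t. g (x0 - \<tau> *\<^sub>R h) \<bullet> (- t *\<^sub>R h))) (at \<tau> within {0..1})"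
      if "0 \<le> \<tau>" "\<tau> \<le> 1" for \<tau>
      by (rule has_derivative_in_compose[of "\<lambda>\<tau>. x0 - \<tau> *\<^sub>R h"])
        (use seg that in \<open>auto intro!: derivative_eq_intros has_derivative_subset[OF f]\<close>)
    have "\<exists>\<tau>\<in>{0..1}. F 1 - F 0 = g (x0 + \<tau> *\<^sub>R h) \<bullet> ((1 - 0) *\<^sub>R h) + g (x0 - \<tau> *\<^sub>R h) \<bullet> (- (1 - 0) *\<^sub>R h)"
      unfolding F_def
    proof (rule mvt_very_simple[where f' = "\<lambda>\<tau> t. g (x0 + \<tau> *\<^sub>R h) \<bullet> (t *\<^sub>R h) + g (x0 - \<tau> *\<^sub>R h) \<bullet> (- t *\<^sub>R h)"])
      fix \<tau> :: real assume "0 \<le> \<tau>" "\<tau> \<le> 1"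
      then show "((\<lambda>\<tau>. f (x0 + \<tau> *\<^sub>R h) + f (x0 - \<tau> *\<^sub>R h)) has_derivative
          (\<lambda>t. g (x0 + \<tau> *\<^sub>R h) \<bullet> (t *\<^sub>R h) + g (x0 - \<tau> *\<^sub>R h) \<bullet> (- t *\<^sub>R h))) (at \<tau> within {0..1})"
        by (intro has_derivative_add 1 2)
    qed simp
    then obtain \<tau> where \<tau>: "0 \<le> \<tau>" "\<tau> \<le> 1"
      "F 1 - F 0 = (g (x0 + \<tau> *\<^sub>R h) - g (x0 - \<tau> *\<^sub>R h)) \<bullet> h"
      by (auto simp: inner_diff_left)
    have "x0 + \<tau> *\<^sub>R h - (x0 - \<tau> *\<^sub>R h) = (2 * \<tau>) *\<^sub>R h"
      by (simp add: scaleR_2 flip: scaleR_scaleR)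
    then have n: "norm (x0 + \<tau> *\<^sub>R h - (x0 - \<tau> *\<^sub>R h)) = 2 * \<tau> * norm h"
      using \<tau> by simp
    have "\<bar>F 1 - F 0\<bar> \<le> M * (2 * \<tau> * norm h) powr \<theta> * norm h"
      unfolding \<tau>(3) using gM[OF seg[OF \<tau>(1,2)], of h] n by simp
    also have "\<dots> \<le> M * (2 * norm h) powr \<theta> * norm h"
      using \<tau> \<theta> M0 mult_right_mono[OF \<tau>(2), of "norm h"] by (intro mult_right_mono mult_left_mono powr_mono2) auto
    also have "\<dots> = (M * 2 powr \<theta>) * norm h powr (1 + \<theta>)"
      by (cases "h = 0") (auto simp: powr_mult powr_add)
    finally show ?thesis by (simp add: F_def algebra_simps)
  qed
  then show ?thesis by blast
qed

text \<open>According to the integer part of \<open>\<beta> = 2 * s + \<gamma>\<close> the exponent is \<open>\<beta>\<close> itself when \<open>\<beta> < 2\<close>, and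
  \<open>2\<close> otherwise, when the gradient is Lipschitz.  For \<open>\<beta> = 1\<close> the Hoelder condition with exponent \<open>0\<close>
  bounds the oscillation of the gradient, which still yields the exponent \<open>1\<close>.\<close>

lemma C_2s_plus_second_difference:
  fixes \<psi> :: "'a::euclidean_space \<Rightarrow> real"
  assumes s: "0 < s" "s < 1" and D: "open D" "x \<in> D" and \<psi>: "C_2s_plus s D \<psi>"
  obtains r p C where "0 < r" "2 * s < p"
    "\<And>h. norm h < r \<Longrightarrow> \<bar>\<psi> (x + h) + \<psi> (x - h) - 2 * \<psi> x\<bar> \<le> C * norm h powr p"
proof -
  obtain r where r: "0 < r" "cball x r \<subseteq> D"
    using D open_contains_cball by blast
  let ?K = "cball x r"
  obtain \<gamma> where \<gamma>: "0 < \<gamma>" "C_real (2 * s + \<gamma>) ?K \<psi>"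
    using \<psi> r unfolding C_2s_plus_def by (meson compact_cball)
  define \<beta> where "\<beta> = 2 * s + \<gamma>"
  have \<beta>: "2 * s < \<beta>" "0 < \<beta>" using \<gamma> s by (auto simp: \<beta>_def)
  have fl: "real (nat \<lfloor>\<beta>\<rfloor>) = \<beta> - frac \<beta>" using \<beta> by (simp add: frac_def)
  have H: "C_hoelder (nat \<lfloor>\<beta>\<rfloor>) (frac \<beta>) ?K \<psi>"
    using \<gamma> by (simp add: C_real_def \<beta>_def)
  consider "nat \<lfloor>\<beta>\<rfloor> = 0" | "nat \<lfloor>\<beta>\<rfloor> = Suc 0" | m where "nat \<lfloor>\<beta>\<rfloor> = Suc (Suc m)"
    by (metis not0_implies_Suc)
  then have "\<exists>p>2 * s. \<exists>C. \<forall>h. norm h < r \<longrightarrow> \<bar>\<psi> (x + h) + \<psi> (x - h) - 2 * \<psi> x\<bar> \<le> C * norm h powr p"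
  proof cases
    case 1
    then have fr: "frac \<beta> = \<beta>" using fl by simp
    have "\<exists>C. \<forall>y\<in>?K. \<forall>z\<in>?K. \<bar>\<psi> y - \<psi> z\<bar> \<le> C * norm (y - z) powr \<beta>"
      using H unfolding 1 fr by simp
    then obtain C where C: "\<And>y z. y \<in> ?K \<Longrightarrow> z \<in> ?K \<Longrightarrow> \<bar>\<psi> y - \<psi> z\<bar> \<le> C * norm (y - z) powr \<beta>"
      by blast
    have "\<bar>\<psi> (x + h) + \<psi> (x - h) - 2 * \<psi> x\<bar> \<le> (2 * C) * norm h powr \<beta>" if "norm h < r" for h
      using that r C[of "x + h" x] C[of "x - h" x] by (auto simp: dist_norm)
    then show ?thesis using \<beta> by blast
  next
    case 2
    then have b: "\<beta> = 1 + frac \<beta>" using fl by simp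
    have "\<exists>g. (\<forall>y\<in>?K. (\<psi> has_derivative (\<lambda>h. g y \<bullet> h)) (at y within ?K)) \<and>
        (\<forall>b\<in>Basis. \<exists>C. \<forall>y\<in>?K. \<forall>z\<in>?K. \<bar>g y \<bullet> b - g z \<bullet> b\<bar> \<le> C * norm (y - z) powr frac \<beta>)"
      using H unfolding 2 C_hoelder.simps by blast
    then obtain g where "\<And>y. y \<in> ?K \<Longrightarrow> (\<psi> has_derivative (\<lambda>h. g y \<bullet> h)) (at y within ?K)"
      "\<And>b. b \<in> Basis \<Longrightarrow> \<exists>C. \<forall>y\<in>?K. \<forall>z\<in>?K. \<bar>g y \<bullet> b - g z \<bullet> b\<bar> \<le> C * norm (y - z) powr frac \<beta>"
      by blast
    from second_difference_of_Hoelder_gradient[OF this] b \<beta> show ?thesis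
      by (metis frac_ge_0)
  next
    case 3
    have "\<exists>g. (\<forall>y\<in>?K. (\<psi> has_derivative (\<lambda>h. g y \<bullet> h)) (at y within ?K)) \<and>
        (\<forall>b\<in>Basis. C_hoelder (Suc m) (frac \<beta>) ?K (\<lambda>y. g y \<bullet> b))"
      using H unfolding 3 C_hoelder.simps(2)[of "Suc m"] by blast
    then obtain g where g: "\<And>y. y \<in> ?K \<Longrightarrow> (\<psi> has_derivative (\<lambda>h. g y \<bullet> h)) (at y within ?K)"
      "\<And>b. b \<in> Basis \<Longrightarrow> C_hoelder (Suc m) (frac \<beta>) ?K (\<lambda>y. g y \<bullet> b)"
      by blast
    have "\<exists>C. \<forall>y\<in>?K. \<forall>z\<in>?K. \<bar>g y \<bullet> b - g z \<bullet> b\<bar> \<le> C * norm (y - z) powr 1" if "b \<in> Basis" for b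
      using C_hoelder_Suc_Lipschitz[OF g(2)[OF that] convex_cball] by simp
    from second_difference_of_Hoelder_gradient[OF g(1) this] have
      "\<exists>C. \<forall>h. norm h < r \<longrightarrow> \<bar>\<psi> (x + h) + \<psi> (x - h) - 2 * \<psi> x\<bar> \<le> C * norm h powr 2"
      by simp
    then show ?thesis using s by (intro exI[of _ 2]) auto
  qed
  then show ?thesis using that r by blast
qed

context stable_kernel
begin

lemma C_2s_plus_L_integrand_integrable:
  assumes "open D" "x \<in> D" "\<psi> \<in> bcontfun" "C_2s_plus s D \<psi>"
  shows "integrable lborel (L_integrand k s \<psi> x)"
proof -
  obtain r p C where "0 < r" "2 * s < p"
    "\<And>h. norm h < r \<Longrightarrow> \<bar>\<psi> (x + h) + \<psi> (x - h) - 2 * \<psi> x\<bar> \<le> C * norm h powr p"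
    using C_2s_plus_second_difference[OF s assms(1,2,4)] by metis
  moreover obtain B where "\<And>y. \<bar>\<psi> y\<bar> \<le> B" using bcontfun_abs_bound[OF assms(3)] by blast
  ultimately show ?thesis
    by (intro L_integrand_integrable_of_second_difference borel_measurable_continuous_onI
        bcontfun_continuous[OF assms(3)])
qed

end

section \<open>The comparison principle\<close>

context stable_kernel
begin

text \<open>On \<open>ball 0 R\<close> the kernel is at least a multiple of \<open>R powr - (DIM('a) + 2 * s)\<close>.  If \<open>\<Omega>\<close> and
  \<open>ball 0 \<rho>\<close> take away at most half of the volume of \<open>ball 0 R\<close>, the rest has mass of order
  \<open>R powr - (2 * s)\<close>, which is as large as desired for small \<open>R\<close>.\<close>

lemma kernel_mass_off_small_set:
  fixes N :: real
  assumes N: "0 < N"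
  obtains \<delta> \<rho>0 where "0 < \<delta>" "0 < \<rho>0"
    "\<And>\<Omega> x \<rho>. \<Omega> \<in> sets borel \<Longrightarrow> emeasure lborel \<Omega> \<le> ennreal \<delta> \<Longrightarrow> 0 < \<rho> \<Longrightarrow> \<rho> < \<rho>0 \<Longrightarrow>
      N \<le> (LINT h:- ball 0 \<rho> - (\<lambda>h. x + h) -` \<Omega>|lborel. j h)"
proof -
  obtain \<Lambda>1 \<Lambda>2 where L: "0 < \<Lambda>1"
    "\<And>y. y \<noteq> 0 \<Longrightarrow> \<Lambda>1 * norm y powr - (real DIM('a) + 2 * s) \<le> j y"
    using kernel_bounds by metis
  define d where "d = DIM('a)"
  define \<omega> where "\<omega> = measure lborel (ball (0::'a) 1)"
  have \<omega>: "0 < \<omega>" using content_ball_pos[of 1 "0::'a"] by (simp add: \<omega>_def)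
  \<comment> \<open>The radius for which the lower bound \<open>\<Lambda>1 * \<omega> * R powr - (2 * s) / 2\<close> equals \<open>N\<close>.\<close>
  define R where "R = (2 * N / (\<Lambda>1 * \<omega>)) powr - (1 / (2 * s))"
  have R: "0 < R" using N L \<omega> by (simp add: R_def)
  have RN: "R powr - (2 * s) = 2 * N / (\<Lambda>1 * \<omega>)"
    using N L \<omega> s by (simp add: R_def powr_powr)
  define \<delta> where "\<delta> = \<omega> * R ^ d / 4"
  define \<rho>0 where "\<rho>0 = R / 4"
  show ?thesis
  proof
    show "0 < \<delta>" "0 < \<rho>0" using R \<omega> by (auto simp: \<delta>_def \<rho>0_def)
    fix \<Omega> :: "'a set" and x \<rho>
    assume \<Omega>: "\<Omega> \<in> sets borel" "emeasure lborel \<Omega> \<le> ennreal \<delta>" and \<rho>: "0 < \<rho>" "\<rho> < \<rho>0"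
    define T where "T = (\<lambda>h. x + h) -` \<Omega>"
    have Tb: "T \<in> sets borel"
      using \<Omega>(1) measurable_sets[of "\<lambda>h. x + h" borel borel \<Omega>] by (simp add: T_def)
    have Te: "emeasure lborel T \<le> ennreal \<delta>"
    proof -
      have "emeasure lborel \<Omega> = emeasure (distr lborel borel ((+) x)) \<Omega>"
        by (simp add: lborel_distr_plus)
      also have "\<dots> = emeasure lborel T"
        using \<Omega>(1) by (subst emeasure_distr) (auto simp: T_def)
      finally show ?thesis using \<Omega> by simp
    qed
    define A where "A = - ball 0 \<rho> - T"
    have Ab: "A \<in> sets borel" using Tb by (simp add: A_def)
    have fin: "ball (0::'a) t \<in> fmeasurable lborel" for t
      using emeasure_lborel_ball_finite[of 0 t] by (auto intro: fmeasurableI)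
    have Tf: "T \<in> fmeasurable lborel"
      using Tb Te by (intro fmeasurableI) (auto simp: order_le_less_trans)
    have Tm: "measure lborel T \<le> \<delta>"
      unfolding measure_def using Te \<omega> R by (intro enn2real_leI) (auto simp: \<delta>_def)
    have vol: "measure lborel (ball (0::'a) t) = t ^ d * \<omega>" if "0 \<le> t" for t
      unfolding d_def \<omega>_def using that by (rule content_ball_conv_unit_ball)
    have AR: "ball 0 R \<inter> A \<in> fmeasurable lborel"
      using fin Ab by (intro fmeasurable_Int_fmeasurable) auto
    have "R ^ d * \<omega> \<le> measure lborel ((ball 0 R \<inter> A) \<union> (ball 0 \<rho> \<union> T))"
      unfolding vol[of R, symmetric, OF less_imp_le[OF R]]
      by (rule measure_mono_fmeasurable) (use fin Tf AR Ab in \<open>auto simp: A_def\<close>)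
    also have "\<dots> \<le> measure lborel (ball 0 R \<inter> A) + measure lborel (ball 0 \<rho> \<union> T)"
      by (rule measure_Un_le) (use AR Tf in auto)
    also have "measure lborel (ball 0 \<rho> \<union> T) \<le> measure lborel (ball (0::'a) \<rho>) + measure lborel T"
      by (rule measure_Un_le) (use Tf in auto)
    also have "measure lborel (ball (0::'a) \<rho>) \<le> \<omega> * R ^ d / 4"
    proof -
      have "\<rho> ^ d \<le> (R / 4) ^ d"
        using \<rho> by (intro power_mono) (auto simp: \<rho>0_def)
      also have "\<dots> = R ^ d * (1/4) ^ d"
        by (simp add: power_divide)
      also have "\<dots> \<le> R ^ d * (1/4) ^ 1"
        using R by (intro mult_left_mono power_decreasing) (auto simp: d_def Suc_le_eq)
      finally have "\<rho> ^ d * \<omega> \<le> (R ^ d * (1/4) ^ 1) * \<omega>"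
        using \<omega> by (intro mult_right_mono) auto
      then show ?thesis using \<rho> by (simp add: vol mult.commute)
    qed
    finally have mA: "\<omega> * R ^ d / 2 \<le> measure lborel (ball 0 R \<inter> A)"
      using Tm by (simp add: \<delta>_def mult.commute)
    have jA: "set_integrable lborel A j"
      by (rule set_integrable_subset[OF jump_density_far_integrable[OF \<rho>(1)]]) (use Ab in \<open>auto simp: A_def\<close>)
    have jRA: "set_integrable lborel (ball 0 R \<inter> A) j"
      by (rule set_integrable_subset[OF jA]) (use Ab in auto)
    have jR: "\<Lambda>1 * R powr - (real d + 2 * s) \<le> j h" if "h \<in> ball 0 R \<inter> A" for h
    proof -
      have h: "h \<noteq> 0" "norm h \<le> R" using that \<rho> by (auto simp: A_def)
      have "\<Lambda>1 * R powr - (real d + 2 * s) \<le> \<Lambda>1 * norm h powr - (real d + 2 * s)"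
        using h L(1) s by (intro mult_left_mono powr_mono2') auto
      also have "\<dots> \<le> j h" using L(2)[OF h(1)] by (simp add: d_def)
      finally show ?thesis .
    qed
    have "N = \<Lambda>1 * R powr - (real d + 2 * s) * (\<omega> * R ^ d / 2)"
    proof -
      have "R powr - (real d + 2 * s) * R ^ d = R powr - (2 * s)"
        using R by (simp add: powr_realpow[symmetric] powr_add[symmetric])
      then have "\<Lambda>1 * R powr - (real d + 2 * s) * (\<omega> * R ^ d / 2) = \<Lambda>1 * \<omega> * R powr - (2 * s) / 2"
        by (simp add: mult_ac)
      then show ?thesis unfolding RN using L(1) \<omega> by simp
    qed
    also have "\<dots> \<le> \<Lambda>1 * R powr - (real d + 2 * s) * measure lborel (ball 0 R \<inter> A)"
      using L(1) mA by (intro mult_left_mono) auto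
    also have "\<dots> = (LINT h:ball 0 R \<inter> A|lborel. \<Lambda>1 * R powr - (real d + 2 * s))"
      using AR by (subst set_integral_const) (auto simp: fmeasurable_def)
    also have "\<dots> \<le> (LINT h:ball 0 R \<inter> A|lborel. j h)"
      by (rule set_integral_mono)
        (use jR AR jRA in \<open>auto simp: set_integrable_def fmeasurable_def\<close>)
    also have "\<dots> \<le> (LINT h:A|lborel. j h)"
      unfolding set_lebesgue_integral_def
      by (rule integral_mono)
        (use jRA jA jump_density_nonneg in \<open>auto simp: set_integrable_def indicator_def\<close>)
    finally show "N \<le> (LINT h:- ball 0 \<rho> - (\<lambda>h. x + h) -` \<Omega>|lborel. j h)"
      by (simp add: A_def T_def)
  qed
qed

text \<open>At a maximum every jump lowers the function or keeps its value, and a jump to the complement of \<open>\<Omega>\<close>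
  lowers it by at least \<open>W x\<close>.  Only one of the two jumps \<open>h\<close>, \<open>- h\<close> in the second difference is
  counted, whence the factor \<open>1 / 2\<close>.\<close>

lemma L_trunc_le_at_maximum:
  assumes W: "W \<in> bcontfun" and max: "\<And>y. W y \<le> W x" and \<rho>: "0 < \<rho>"
    and \<Omega>: "\<Omega> \<in> sets borel" "\<And>y. y \<notin> \<Omega> \<Longrightarrow> W y \<le> 0"
  shows "L_trunc k s \<rho> W x \<le> - (W x / 2) * (LINT h:- ball 0 \<rho> - (\<lambda>h. x + h) -` \<Omega>|lborel. j h)"
proof -
  let ?T = "(\<lambda>h. x + h) -` \<Omega>"
  have i: "set_integrable lborel (- ball 0 \<rho>) (L_integrand k s W x)"
    by (rule L_integrand_far_integrable_bcontfun[OF W \<rho>])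
  have T: "?T \<in> sets borel"
    using \<Omega>(1) measurable_sets[of "\<lambda>h. x + h" borel borel \<Omega>] by simp
  have iT: "set_integrable lborel (- ball 0 \<rho> - ?T) (\<lambda>h. - W x * j h)"
    by (intro set_integrable_mult_right set_integrable_subset[OF jump_density_far_integrable[OF \<rho>]])
      (use T in auto)
  have "(LINT h:- ball 0 \<rho>|lborel. L_integrand k s W x h) \<le> (LINT h:- ball 0 \<rho> - ?T|lborel. - W x * j h)"
    unfolding set_lebesgue_integral_def
  proof (rule integral_mono)
    fix h
    have "W (x + h) + W (x - h) - 2 * W x \<le> (if x + h \<in> \<Omega> then 0 else - W x)"
      using max[of "x + h"] max[of "x - h"] \<Omega>(2)[of "x + h"] by auto
    then have "L_integrand k s W x h \<le> (if x + h \<in> \<Omega> then 0 else - W x) * j h"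
      unfolding L_integrand_def by (intro mult_right_mono jump_density_nonneg)
    then show "indicator (- ball 0 \<rho>) h *\<^sub>R L_integrand k s W x h \<le> indicator (- ball 0 \<rho> - ?T) h *\<^sub>R (- W x * j h)"
      by (auto simp: indicator_def)
  qed (use i iT in \<open>auto simp: set_integrable_def\<close>)
  moreover have "(LINT h:- ball 0 \<rho> - ?T|lborel. - W x * j h) = - W x * (LINT h:- ball 0 \<rho> - ?T|lborel. j h)"
    by (rule set_integral_mult_right)
  ultimately show ?thesis unfolding L_trunc_def by linarith
qed

text \<open>The function \<open>W = u - v - t \<psi>\<close> cannot be positive because too much of the kernel leaves \<open>D - K\<close>, and
  \<open>t > 0\<close> is impossible by the strictness of the supersolution \<open>\<psi>\<close>.\<close>

lemma comparison_principle:
  assumes D: "open D" "bounded D" "D \<noteq> {}"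
    and V: "continuous_on D V" "\<And>x. x \<in> D \<Longrightarrow> \<bar>V x\<bar> \<le> N"
    and \<psi>: "\<psi> \<in> eigen_supersolutions k s V D lam" "0 < lam"
    and u: "viscosity_subsolution k s D V (\<lambda>_. 0) u"
    and v: "viscosity_supersolution k s D V (\<lambda>_. 0) v"
    and outside: "\<And>x. x \<notin> D \<Longrightarrow> u x \<le> v x"
  shows "u x \<le> v x"
proof -
  have bc: "u \<in> bcontfun" "v \<in> bcontfun" "\<psi> \<in> bcontfun"
    using u v \<psi> by (auto simp: viscosity_subsolution_def viscosity_supersolution_def eigen_supersolutions_def)
  have \<psi>0: "\<And>x. 0 \<le> \<psi> x" "\<And>x. x \<in> D \<Longrightarrow> 0 < \<psi> x" "C_2s_plus s D \<psi>"
    and L\<psi>: "\<And>x. x \<in> D \<Longrightarrow> L_op k s \<psi> x \<le> (V x - lam) * \<psi> x"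
    using \<psi>(1) by (auto simp: eigen_supersolutions_def algebra_simps)
  have cont: "continuous_on S u" "continuous_on S v" "continuous_on S \<psi>" for S
    using bc by (auto intro: bcontfun_continuous)
  have N: "0 \<le> N" using V(2) D(3) by fastforce
  obtain \<delta> \<rho>0 where \<delta>: "0 < \<delta>" "0 < \<rho>0" and mass:
    "\<And>\<Omega> x \<rho>. \<Omega> \<in> sets borel \<Longrightarrow> emeasure lborel \<Omega> \<le> ennreal \<delta> \<Longrightarrow> 0 < \<rho> \<Longrightarrow> \<rho> < \<rho>0 \<Longrightarrow>
      2 * N + 4 \<le> (LINT h:- ball 0 \<rho> - (\<lambda>h. x + h) -` \<Omega>|lborel. j h)"
    using kernel_mass_off_small_set[of "2 * N + 4"] N by (metis add_nonneg_pos mult_nonneg_nonneg zero_le_numeral zero_less_numeral)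
  obtain K0 where K0: "closed K0" "K0 \<subseteq> D" "emeasure lebesgue (D - K0) < ennreal \<delta>"
    using sets_lebesgue_inner_closed[of D \<delta>] D(1) \<delta>(1) by (metis borel_open sets_completionI_sets sets_lborel)
  obtain z where z: "z \<in> D" using D(3) by blast
  \<comment> \<open>A point is added because the compact set has to be nonempty for the quotient to attain a maximum on it.\<close>
  define K where "K = insert z K0"
  have K: "compact K" "K \<subseteq> D" "K \<noteq> {}"
    using K0 D(2) z by (auto simp: K_def compact_eq_bounded_closed intro: bounded_subset)
  have DK: "D - K \<in> sets borel" "emeasure lborel (D - K) \<le> ennreal \<delta>"
  proof -
    show b: "D - K \<in> sets borel"
      using D(1) K(1) by (intro sets.Diff) (auto simp: borel_open borel_compact)
    have "emeasure lborel (D - K) = emeasure lebesgue (D - K)"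
      using b by simp
    also have "\<dots> \<le> emeasure lebesgue (D - K0)"
      using D(1) K0(1) by (intro emeasure_mono) (auto simp: K_def)
    finally show "emeasure lborel (D - K) \<le> ennreal \<delta>" using K0(3) by simp
  qed
  have "continuous_on K (\<lambda>x. (u x - v x) / \<psi> x)"
    using K(2) \<psi>0(2) by (intro continuous_intros cont) (fastforce dest: \<psi>0(2))
  then obtain x1 where x1: "x1 \<in> K" "\<And>y. y \<in> K \<Longrightarrow> (u y - v y) / \<psi> y \<le> (u x1 - v x1) / \<psi> x1"
    using continuous_attains_sup[OF K(1,3)] by blast
  define t where "t = max 0 ((u x1 - v x1) / \<psi> x1)"
  have t0: "0 \<le> t" by (simp add: t_def)
  define W where "W x = (u x + - v x) + - t * \<psi> x" for x
  define g where "g x = ((0 - V x * u x) + (V x * v x - 0)) + t * ((V x - lam) * \<psi> x)" for x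
  have g: "- g x = V x * W x + lam * t * \<psi> x" for x
    by (simp add: g_def W_def algebra_simps)
  have Wbc: "W \<in> bcontfun"
    unfolding W_def using bc scaleR_cont[of \<psi> "- t"] by (intro plus_cont uminus_cont) auto
  have sub: "punctual_subsolution k s D g W"
    unfolding g_def W_def
    using viscosity_subsolution_punctual[OF D(1) u] viscosity_supersolution_punctual[OF D(1) v]
      classical_supersolution_punctual[OF C_2s_plus_L_integrand_integrable[OF D(1) _ bc(3) \<psi>0(3)] L\<psi> t0]
      bc scaleR_cont[OF bc(3), of "- t"]
    by (intro punctual_subsolution_add D(1) continuous_intros cont V(1) plus_cont uminus_cont) auto
  have outW: "W y \<le> 0" if "y \<notin> D - K" for y
  proof (cases "y \<in> K")
    case True
    then have "(u y - v y) / \<psi> y \<le> t" "0 < \<psi> y"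
      using x1(2)[OF True] K(2) \<psi>0(2) by (auto simp: t_def)
    then show ?thesis by (simp add: W_def field_simps)
  next
    case False
    then show ?thesis using that outside[of y] mult_nonneg_nonneg[OF t0 \<psi>0(1)[of y]] by (auto simp: W_def)
  qed
  have at_max: "\<forall>\<^sub>F \<rho> in at_right 0. V x * W x + lam * t * \<psi> x \<le> L_trunc k s \<rho> W x + e"
    if "x \<in> D" "\<And>y. W y \<le> W x" "0 < e" for x e
    using sub[unfolded punctual_subsolution_def, rule_format, OF that(1) _ that(3), of 0 0] that(2)
    by (simp add: g)
  have W0: "W y \<le> 0" for y
  proof -
    have "compact (closure D)" "closure D \<noteq> {}"
      using D by (auto simp: compact_closure)
    then obtain x2 where x2: "x2 \<in> closure D" "\<And>y. y \<in> closure D \<Longrightarrow> W y \<le> W x2"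
      using continuous_attains_sup[OF _ _ bcontfun_continuous[OF Wbc]] by blast
    have "W x2 \<le> 0"
    proof (rule ccontr)
      assume "\<not> W x2 \<le> 0"
      then have pos: "0 < W x2" by simp
      have x2D: "x2 \<in> D" using outW[of x2] pos by auto
      have max: "W y \<le> W x2" for y
        using x2(2)[of y] outW[of y] pos closure_subset[of D] by fastforce
      \<comment> \<open>The error is allowed to be the maximum \<open>W x2\<close> itself: the mass \<open>2 * N + 4\<close> leaves a surplus of \<open>2 * W x2\<close> over the zero order term.\<close>
      have "\<forall>\<^sub>F \<rho> in at_right 0. 0 < \<rho> \<and> \<rho> < \<rho>0"
        using eventually_at_right_real[of 0 \<rho>0] \<delta> by simp
      from eventually_happens'[OF _ eventually_conj[OF this at_max[OF x2D max pos]]]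
      obtain \<rho> where \<rho>: "0 < \<rho>" "\<rho> < \<rho>0" "V x2 * W x2 + lam * t * \<psi> x2 \<le> L_trunc k s \<rho> W x2 + W x2"
        by auto
      have "L_trunc k s \<rho> W x2 \<le> - (W x2 / 2) * (LINT h:- ball 0 \<rho> - (\<lambda>h. x2 + h) -` (D - K)|lborel. j h)"
        by (intro L_trunc_le_at_maximum Wbc max \<rho> DK outW)
      also have "\<dots> \<le> - (W x2 / 2) * (2 * N + 4)"
        using pos mass[OF DK \<rho>(1,2), of x2] by (intro mult_left_mono_neg) auto
      finally have "V x2 * W x2 + lam * t * \<psi> x2 \<le> - (N + 1) * W x2"
        using \<rho>(3) by (simp add: algebra_simps)
      moreover have "- N * W x2 \<le> V x2 * W x2"
        using V(2)[OF x2D] pos by (intro mult_right_mono) auto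
      moreover have "0 \<le> lam * t * \<psi> x2"
        using \<psi>(2) t0 \<psi>0(1) by simp
      ultimately show False using pos by (simp add: algebra_simps)
    qed
    then show ?thesis
      using x2(2)[of y] outW[of y] closure_subset[of D] by fastforce
  qed
  have "t = 0"
  proof (rule ccontr)
    assume "t \<noteq> 0"
    then have t: "0 < t" "t = (u x1 - v x1) / \<psi> x1"
      using t0 by (simp, auto simp: t_def max_def)
    have x1D: "x1 \<in> D" "0 < \<psi> x1" using x1(1) K(2) \<psi>0(2) by auto
    have Wx1: "W x1 = 0" using t(2) x1D(2) by (simp add: W_def field_simps)
    \<comment> \<open>Here \<open>t \<psi>\<close> touches \<open>u - v\<close> from above at \<open>x1\<close>, and strictness of the supersolution is contradicted.\<close>
    define e where "e = lam * t * \<psi> x1"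
    have e: "0 < e" using \<psi>(2) t(1) x1D by (simp add: e_def)
    have "\<forall>\<^sub>F \<rho> in at_right 0. V x1 * W x1 + lam * t * \<psi> x1 \<le> L_trunc k s \<rho> W x1 + e / 2"
      using W0 e by (intro at_max x1D) (auto simp: Wx1)
    from eventually_happens'[OF _ eventually_conj[OF eventually_at_right_less[of 0] this]]
    obtain \<rho> where \<rho>: "0 < \<rho>" "V x1 * W x1 + lam * t * \<psi> x1 \<le> L_trunc k s \<rho> W x1 + e / 2"
      by auto
    have "L_trunc k s \<rho> W x1 \<le> 0"
      using L_trunc_le_at_maximum[OF Wbc _ \<rho>(1), of x1 UNIV] W0 by (simp add: Wx1)
    then show False using \<rho>(2) e by (simp add: Wx1 e_def)
  qed
  then show ?thesis using W0[of x] by (simp add: W_def)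
qed

end

theorem theorem1p2:
  fixes D :: "'a::euclidean_space set"
    and k V u v :: "'a \<Rightarrow> real"
    and s \<alpha> :: real
  assumes "bounded_C2_domain D"
    and "0 < s" "s < 1"
    and "admissible_kernel k"
    and "0 < \<alpha>" "C_real \<alpha> (closure D) V"
    and "principal_eigenvalue k s V D > 0"
    and "viscosity_subsolution k s D V (\<lambda>x. 0) u"
    and "viscosity_supersolution k s D V (\<lambda>x. 0) v"
    and "\<forall>x. x \<notin> D \<longrightarrow> u x \<le> v x"
  shows "\<forall>x. u x \<le> v x"
proof -
  interpret stable_kernel k s
    using assms by unfold_locales
  have D: "open D" "bounded D" "D \<noteq> {}"
    using assms(1) by (auto simp: bounded_C2_domain_def)
  have V: "continuous_on (closure D) V" "bounded (V ` closure D)"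
    using assms(6) unfolding C_real_def by (auto intro: C_hoelder_continuous_on C_hoelder_bounded)
  then obtain N where N: "\<And>x. x \<in> D \<Longrightarrow> \<bar>V x\<bar> \<le> N"
    using closure_subset[of D] by (fastforce simp: bounded_iff)
  obtain lam \<psi> where "0 < lam" "\<psi> \<in> eigen_supersolutions k s V D lam"
    using assms(7) by (auto simp: principal_eigenvalue_def less_Sup_iff)
  then show ?thesis
    using comparison_principle[OF D continuous_on_subset[OF V(1) closure_subset] N _ _ assms(8,9)] assms(10)
    by blast
qed

end
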